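(* The $\exists$-EF-universality problem is undecidable for open bounded L/U-PTBP with one clock in the clique semantics.
   Context: A PTBP is a tuple $\mathcal N=(Q,X,\Sigma,P,q_0,\Delta)$ with finite states $Q$, finite clocks $X$, finite alphabet $\Sigma$, finite timing parameters $P$, initial state $q_0$, and finite edges $\Delta\subseteq Q\times G\times Act\times 2^X\times Q$, where a guard is a finite conjunction of constraints $x\bowtie a$ ($x\in X$, $\bowtie\in\{<,\le,=,\ge,>\}$, $a\in\mathbb Q_{\ge0}\cup P$), $Act=\{\epsilon\}\cup\{!!m,??m:m\in\Sigma\}$, and the subset of $X$ is the set of clocks reset. An L/U-PTBP is a PTBP whose parameters are partitioned into upper-bound parameters (occurring only in $x<p$ or $x\le p$) and lower-bound parameters (occurring only in $x>p$ or $x\ge p$). A bounded PTBP is a pair $(\mathcal N,\mathit{bounds})$ where $\mathit{bounds}$ assigns to each parameter an interval $[a,b]$, $(a,b]$, $[a,b)$ or $(a,b)$ with $a,b\in\mathbb N$; it is open bounded if it is not closed, i.e. some interval is not of the form $[a,b]$. A parameter valuation $\pi:P\to\mathbb Q_{\ge0}$ belongs to $\mathit{bounds}$ if $\pi(p)\in\mathit{bounds}(p)$ for all $p$. Clock valuations $v:X\to\mathbb R_{\ge0}$; $v\models_\pi g$ if all constraints hold with parameters replaced by their $\pi$-values. Clique semantics: for network size $N$, a configuration is a vector of $N$ (state, clock valuation) pairs, initially all $(q_0,\vec0)$. A transition under $\pi$: a delay $t\ge0$ is added to all clocks; a process $i$ takes an enabled edge $(q_1,g,a,U,q_2)$, moving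 to $q_2$ and resetting $U$; if $a=\epsilon$ others are unchanged; if $a=!!m$, every other process having an enabled edge labelled $??m$ from its current state takes one such edge, others unchanged. $\mathcal E(\mathcal N,N,\pi)$ is the set of maximal executions (infinite, or ending where no transition is possible) from the initial configuration; an execution reaches $q_f$ if some process is in $q_f$ at some configuration. The $\exists$-EF-universality problem: given $(\mathcal N,\mathit{bounds})$ and $q_f$, decide whether $\exists N\in\mathbb N\ \forall\pi\in\mathit{bounds}\ \exists\rho\in\mathcal E(\mathcal N,N,\pi)$ reaching $q_f$. *)

theory Defs
  imports Complex_Main "HOL-Library.Nat_Bijection"
begin

section \<open>Parametric timed broadcast protocols\<close>

datatype comparison = Lt | Le | Eq | Ge | Gt

datatype 'p bound_expr = Const rat | Param 'p

datatype 'm action = Eps | Send 'm | Recv 'm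

type_synonym ('x, 'p) clock_constraint = "'x \<times> comparison \<times> 'p bound_expr"

text \<open>A conjunction is represented by the finite set of its conjuncts.\<close>

type_synonym ('x, 'p) guard = "('x, 'p) clock_constraint set"

type_synonym ('q, 'x, 'm, 'p) edge = "'q \<times> ('x, 'p) guard \<times> 'm action \<times> 'x set \<times> 'q"

record ('q, 'x, 'm, 'p) ptbp =
  states :: "'q set"
  clocks :: "'x set"
  alphabet :: "'m set"
  params :: "'p set"
  init :: 'q
  edges :: "('q, 'x, 'm, 'p) edge set"

definition constraints_over :: "'x set \<Rightarrow> 'p set \<Rightarrow> ('x, 'p) clock_constraint set" where
  "constraints_over X P = X \<times> UNIV \<times> ({Const r | r. r \<ge> 0} \<union> Param ` P)"

definition guards_over :: "'x set \<Rightarrow> 'p set \<Rightarrow> ('x, 'p) guard set" where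
  "guards_over X P = {g. finite g \<and> g \<subseteq> constraints_over X P}"

definition actions_over :: "'m set \<Rightarrow> 'm action set" where
  "actions_over M = {Eps} \<union> Send ` M \<union> Recv ` M"

definition is_ptbp :: "('q, 'x, 'm, 'p) ptbp \<Rightarrow> bool" where
  "is_ptbp A \<longleftrightarrow>
     finite (states A) \<and> finite (clocks A) \<and> finite (alphabet A) \<and> finite (params A) \<and>
     init A \<in> states A \<and> finite (edges A) \<and>
     edges A \<subseteq> states A \<times> guards_over (clocks A) (params A) \<times> actions_over (alphabet A)
                 \<times> Pow (clocks A) \<times> states A"

definition is_LU :: "('q, 'x, 'm, 'p) ptbp \<Rightarrow> bool" where
  "is_LU A \<longleftrightarrow>
     (\<exists>Up Low. Up \<union> Low = params A \<and> Up \<inter> Low = {} \<and>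
        (\<forall>(q, g, a, R, q') \<in> edges A. \<forall>(x, c, b) \<in> g. \<forall>p. b = Param p \<longrightarrow>
           (p \<in> Up \<longrightarrow> c \<in> {Lt, Le}) \<and> (p \<in> Low \<longrightarrow> c \<in> {Gt, Ge})))"

datatype interval =
    ClosedIv nat nat     \<comment> \<open>$[a,b]$\<close>
  | LeftOpenIv nat nat   \<comment> \<open>$(a,b]$\<close>
  | RightOpenIv nat nat  \<comment> \<open>$[a,b)$\<close>
  | OpenIv nat nat       \<comment> \<open>$(a,b)$\<close>

fun interval_set :: "interval \<Rightarrow> rat set" where
  "interval_set (ClosedIv a b) = {of_nat a .. of_nat b}"
| "interval_set (LeftOpenIv a b) = {of_nat a <.. of_nat b}"
| "interval_set (RightOpenIv a b) = {of_nat a ..< of_nat b}"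
| "interval_set (OpenIv a b) = {of_nat a <..< of_nat b}"

text \<open>Bounds and parameter valuations are total functions on parameter names;
  only their values on \<open>params A\<close> matter.\<close>

definition open_bounded :: "('q, 'x, 'm, 'p) ptbp \<Rightarrow> ('p \<Rightarrow> interval) \<Rightarrow> bool" where
  "open_bounded A bnds \<longleftrightarrow> \<not> (\<forall>p \<in> params A. \<exists>a b. bnds p = ClosedIv a b)"

definition valuations_in ::
    "('q, 'x, 'm, 'p) ptbp \<Rightarrow> ('p \<Rightarrow> interval) \<Rightarrow> ('p \<Rightarrow> rat) set" where
  "valuations_in A bnds = {\<pi>. \<forall>p \<in> params A. \<pi> p \<ge> 0 \<and> \<pi> p \<in> interval_set (bnds p)}"

section \<open>Clique semantics\<close>

fun compare :: "comparison \<Rightarrow> real \<Rightarrow> real \<Rightarrow> bool" where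
  "compare Lt x y \<longleftrightarrow> x < y"
| "compare Le x y \<longleftrightarrow> x \<le> y"
| "compare Eq x y \<longleftrightarrow> x = y"
| "compare Ge x y \<longleftrightarrow> x \<ge> y"
| "compare Gt x y \<longleftrightarrow> x > y"

fun bound_value :: "('p \<Rightarrow> rat) \<Rightarrow> 'p bound_expr \<Rightarrow> rat" where
  "bound_value \<pi> (Const r) = r"
| "bound_value \<pi> (Param p) = \<pi> p"

definition satisfies :: "('p \<Rightarrow> rat) \<Rightarrow> ('x \<Rightarrow> real) \<Rightarrow> ('x, 'p) guard \<Rightarrow> bool" where
  "satisfies \<pi> v g \<longleftrightarrow> (\<forall>(x, c, b) \<in> g. compare c (v x) (of_rat (bound_value \<pi> b)))"

type_synonym ('q, 'x) process = "'q \<times> ('x \<Rightarrow> real)"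

type_synonym ('q, 'x) config = "('q, 'x) process list"

definition reset :: "'x set \<Rightarrow> ('x \<Rightarrow> real) \<Rightarrow> 'x \<Rightarrow> real" where
  "reset R v = (\<lambda>x. if x \<in> R then 0 else v x)"

definition delay :: "real \<Rightarrow> ('q, 'x) config \<Rightarrow> ('q, 'x) config" where
  "delay t c = map (\<lambda>(q, v). (q, \<lambda>x. v x + t)) c"

definition initial_config :: "('q, 'x, 'm, 'p) ptbp \<Rightarrow> nat \<Rightarrow> ('q, 'x) config" where
  "initial_config A N = replicate N (init A, \<lambda>x. 0)"

text \<open>One process takes one enabled edge labelled \<open>a\<close>.\<close>

inductive fires :: "('q, 'x, 'm, 'p) ptbp \<Rightarrow> ('p \<Rightarrow> rat) \<Rightarrow> 'm action
    \<Rightarrow> ('q, 'x) process \<Rightarrow> ('q, 'x) process \<Rightarrow> bool"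
  for A \<pi> where
  "(q, g, a, R, q') \<in> edges A \<Longrightarrow> satisfies \<pi> v g \<Longrightarrow> fires A \<pi> a (q, v) (q', reset R v)"

text \<open>A process cannot decline a message it is able to receive.\<close>

definition receives :: "('q, 'x, 'm, 'p) ptbp \<Rightarrow> ('p \<Rightarrow> rat) \<Rightarrow> 'm
    \<Rightarrow> ('q, 'x) process \<Rightarrow> ('q, 'x) process \<Rightarrow> bool" where
  "receives A \<pi> m s s' \<longleftrightarrow>
     (if \<exists>s''. fires A \<pi> (Recv m) s s'' then fires A \<pi> (Recv m) s s' else s' = s)"

text \<open>In the two discrete rules, \<open>i\<close> is the acting process, and all guards are evaluated on the
  configuration reached after the delay.\<close>

inductive discrete_step :: "('q, 'x, 'm, 'p) ptbp \<Rightarrow> ('p \<Rightarrow> rat)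
    \<Rightarrow> ('q, 'x) config \<Rightarrow> ('q, 'x) config \<Rightarrow> bool"
  for A \<pi> where
  internal: "length c' = length c \<Longrightarrow> i < length c \<Longrightarrow> fires A \<pi> Eps (c ! i) (c' ! i) \<Longrightarrow>
     (\<And>j. j < length c \<Longrightarrow> j \<noteq> i \<Longrightarrow> c' ! j = c ! j) \<Longrightarrow> discrete_step A \<pi> c c'"
| broadcast: "length c' = length c \<Longrightarrow> i < length c \<Longrightarrow> fires A \<pi> (Send m) (c ! i) (c' ! i) \<Longrightarrow>
     (\<And>j. j < length c \<Longrightarrow> j \<noteq> i \<Longrightarrow> receives A \<pi> m (c ! j) (c' ! j)) \<Longrightarrow>
     discrete_step A \<pi> c c'"

definition step :: "('q, 'x, 'm, 'p) ptbp \<Rightarrow> ('p \<Rightarrow> rat)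
    \<Rightarrow> ('q, 'x) config \<Rightarrow> ('q, 'x) config \<Rightarrow> bool" where
  "step A \<pi> c c' \<longleftrightarrow> (\<exists>t \<ge> 0. discrete_step A \<pi> (delay t c) c')"

datatype 'c execution = Finite "'c list" | Infinite "nat \<Rightarrow> 'c"

fun visited :: "'c execution \<Rightarrow> 'c set" where
  "visited (Finite cs) = set cs"
| "visited (Infinite f) = range f"

fun maximal_execution :: "('q, 'x, 'm, 'p) ptbp \<Rightarrow> nat \<Rightarrow> ('p \<Rightarrow> rat)
    \<Rightarrow> ('q, 'x) config execution \<Rightarrow> bool" where
  "maximal_execution A N \<pi> (Finite cs) \<longleftrightarrow>
     cs \<noteq> [] \<and> hd cs = initial_config A N \<and>
     (\<forall>k. Suc k < length cs \<longrightarrow> step A \<pi> (cs ! k) (cs ! Suc k)) \<and>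
     \<not> (\<exists>c'. step A \<pi> (last cs) c')"
| "maximal_execution A N \<pi> (Infinite f) \<longleftrightarrow>
     f 0 = initial_config A N \<and> (\<forall>k. step A \<pi> (f k) (f (Suc k)))"

definition executions :: "('q, 'x, 'm, 'p) ptbp \<Rightarrow> nat \<Rightarrow> ('p \<Rightarrow> rat)
    \<Rightarrow> ('q, 'x) config execution set" where
  "executions A N \<pi> = {\<rho>. maximal_execution A N \<pi> \<rho>}"

definition reaches :: "('q, 'x) config execution \<Rightarrow> 'q \<Rightarrow> bool" where
  "reaches \<rho> qf \<longleftrightarrow> (\<exists>c \<in> visited \<rho>. \<exists>s \<in> set c. fst s = qf)"

section \<open>The decision problem\<close>

text \<open>An instance consists of a protocol, the bounds of its parameters, and a target state. To be
  given as input to an algorithm, states, clocks, messages and parameters are named by natural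
  numbers.\<close>

type_synonym nat_ptbp = "(nat, nat, nat, nat) ptbp"

type_synonym problem_instance = "nat_ptbp \<times> (nat \<Rightarrow> interval) \<times> nat"

definition open_bounded_LU_one_clock :: "problem_instance set" where
  "open_bounded_LU_one_clock =
     {(A, bnds, qf). is_ptbp A \<and> is_LU A \<and> card (clocks A) = 1 \<and> open_bounded A bnds
                     \<and> qf \<in> states A}"

fun exists_EF_universal :: "problem_instance \<Rightarrow> bool" where
  "exists_EF_universal (A, bnds, qf) \<longleftrightarrow>
     (\<exists>N :: nat. \<forall>\<pi> \<in> valuations_in A bnds. \<exists>\<rho> \<in> executions A N \<pi>. reaches \<rho> qf)"

section \<open>Partial recursive functions and decidability\<close>

datatype recf = Zero | Succ | Proj nat | Comp recf "recf list" | PrimRec recf recf | Mu recf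

inductive computes :: "recf \<Rightarrow> nat list \<Rightarrow> nat \<Rightarrow> bool" where
  "computes Zero xs 0"
| "computes Succ [x] (Suc x)"
| "i < length xs \<Longrightarrow> computes (Proj i) xs (xs ! i)"
| "list_all2 (\<lambda>g y. computes g xs y) gs ys \<Longrightarrow> computes f ys z \<Longrightarrow> computes (Comp f gs) xs z"
| "computes f xs y \<Longrightarrow> computes (PrimRec f g) (0 # xs) y"
| "computes (PrimRec f g) (n # xs) r \<Longrightarrow> computes g (n # r # xs) y \<Longrightarrow>
     computes (PrimRec f g) (Suc n # xs) y"
| "computes f (n # xs) 0 \<Longrightarrow> (\<forall>k < n. \<exists>y. computes f (k # xs) (Suc y)) \<Longrightarrow>
     computes (Mu f) xs n"

text \<open>The deciding function need not be defined on numbers that do not encode elements of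
  \<open>I\<close>.\<close>

definition decidable_on :: "('a \<Rightarrow> nat) \<Rightarrow> 'a set \<Rightarrow> ('a \<Rightarrow> bool) \<Rightarrow> bool" where
  "decidable_on enc I Yes \<longleftrightarrow>
     (\<exists>f. \<forall>x \<in> I. computes f [enc x] (if Yes x then 1 else 0))"

section \<open>Encoding of instances\<close>

fun encode_comparison :: "comparison \<Rightarrow> nat" where
  "encode_comparison Lt = 0"
| "encode_comparison Le = 1"
| "encode_comparison Eq = 2"
| "encode_comparison Ge = 3"
| "encode_comparison Gt = 4"

definition encode_rat :: "rat \<Rightarrow> nat" where
  "encode_rat r = (case quotient_of r of (a, b) \<Rightarrow> prod_encode (int_encode a, int_encode b))"

fun encode_bound :: "nat bound_expr \<Rightarrow> nat" where
  "encode_bound (Const r) = sum_encode (Inl (encode_rat r))"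
| "encode_bound (Param p) = sum_encode (Inr p)"

fun encode_constraint :: "(nat, nat) clock_constraint \<Rightarrow> nat" where
  "encode_constraint (x, c, b) = prod_encode (x, prod_encode (encode_comparison c, encode_bound b))"

fun encode_action :: "nat action \<Rightarrow> nat" where
  "encode_action Eps = 0"
| "encode_action (Send m) = Suc (sum_encode (Inl m))"
| "encode_action (Recv m) = Suc (sum_encode (Inr m))"

fun encode_edge :: "(nat, nat, nat, nat) edge \<Rightarrow> nat" where
  "encode_edge (q, g, a, R, q') =
     list_encode [q, set_encode (encode_constraint ` g), encode_action a, set_encode R, q']"

fun encode_interval :: "interval \<Rightarrow> nat" where
  "encode_interval (ClosedIv a b) = list_encode [0, a, b]"
| "encode_interval (LeftOpenIv a b) = list_encode [1, a, b]"
| "encode_interval (RightOpenIv a b) = list_encode [2, a, b]"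
| "encode_interval (OpenIv a b) = list_encode [3, a, b]"

fun encode_instance :: "problem_instance \<Rightarrow> nat" where
  "encode_instance (A, bnds, qf) =
     list_encode
       [set_encode (states A), set_encode (clocks A), set_encode (alphabet A),
        set_encode (params A), init A, set_encode (encode_edge ` edges A),
        set_encode ((\<lambda>p. prod_encode (p, encode_interval (bnds p))) ` params A), qf]"

text \<open>The encoding loses nothing: the code of an instance determines everything but the
  irrelevant values of the bounds outside the parameters.\<close>

lemma inj_encode_comparison: "inj encode_comparison"
proof (rule injI)
  fix c d assume "encode_comparison c = encode_comparison d"
  then show "c = d" by (cases c; cases d) auto
qed

lemma inj_encode_rat: "inj encode_rat"
proof (rule injI)
  fix r s assume "encode_rat r = encode_rat s"
  then have "quotient_of r = quotient_of s"
    by (auto simp: encode_rat_def int_encode_eq split: prod.splits)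
  then show "r = s" by (rule quotient_of_inject)
qed

lemma inj_encode_bound: "inj encode_bound"
proof (rule injI)
  fix b d assume "encode_bound b = encode_bound d"
  then show "b = d"
    by (cases b; cases d) (auto simp: sum_encode_eq dest: injD[OF inj_encode_rat])
qed

lemma inj_encode_constraint: "inj encode_constraint"
  by (rule injI) (auto dest: injD[OF inj_encode_comparison] injD[OF inj_encode_bound])

lemma inj_encode_action: "inj encode_action"
proof (rule injI)
  fix a b assume "encode_action a = encode_action b"
  then show "a = b" by (cases a; cases b) (auto simp: sum_encode_eq)
qed

lemma encode_interval_eq: "encode_interval i = encode_interval j \<longleftrightarrow> i = j"
  by (cases i; cases j) (auto simp: list_encode_eq simp del: list_encode.simps)

lemma inj_on_encode_edge:
  "inj_on encode_edge {(q, g, a, R, q'). finite g \<and> finite R}"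
proof (rule inj_onI)
  fix e f
  assume "e \<in> {(q, g, a, R, q'). finite g \<and> finite R}" "f \<in> {(q, g, a, R, q'). finite g \<and> finite R}"
    and ef: "encode_edge e = encode_edge f"
  then obtain q g a R q' s h b S s' where e: "e = (q, g, a, R, q')" and f: "f = (s, h, b, S, s')"
    and fin: "finite g" "finite R" "finite h" "finite S"
    by blast
  have eq: "encode_edge (q, g, a, R, q') = encode_edge (s, h, b, S, s')"
    using ef e f by simp
  have "encode_constraint ` g = encode_constraint ` h"
    using eq fin by (simp add: list_encode_eq set_encode_eq del: list_encode.simps)
  then have "g = h" by (simp add: inj_image_eq_iff[OF inj_encode_constraint])
  then show "e = f"
    using eq fin e f
    by (auto simp: list_encode_eq set_encode_eq simp del: list_encode.simps
             dest: injD[OF inj_encode_action])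
qed

lemma encode_instance_determines:
  fixes A B :: nat_ptbp
  assumes A: "is_ptbp A" and B: "is_ptbp B"
    and eq: "encode_instance (A, bnds, qf) = encode_instance (B, bnds', qf')"
  shows "A = B \<and> qf = qf' \<and> (\<forall>p \<in> params A. bnds p = bnds' p)"
proof -
  let ?E = "{(q, g, a, R, q'). finite g \<and> finite R} :: (nat, nat, nat, nat) edge set"
  have sub: "edges C \<subseteq> ?E" if "is_ptbp C" for C :: nat_ptbp
  proof -
    have "edges C \<subseteq> states C \<times> guards_over (clocks C) (params C) \<times> actions_over (alphabet C)
                 \<times> Pow (clocks C) \<times> states C" and "finite (clocks C)"
      using that unfolding is_ptbp_def by blast+
    then show ?thesis by (auto simp: guards_over_def intro: finite_subset)
  qed
  have fin: "finite (states C)" "finite (clocks C)" "finite (alphabet C)" "finite (params C)"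
      "finite (edges C)" if "is_ptbp C" for C :: nat_ptbp
    using that by (simp_all add: is_ptbp_def)
  have base: "states A = states B" "clocks A = clocks B" "alphabet A = alphabet B"
      "params A = params B" "init A = init B" "qf = qf'"
    and ed: "encode_edge ` edges A = encode_edge ` edges B"
    and bd: "(\<lambda>p. prod_encode (p, encode_interval (bnds p))) ` params A =
             (\<lambda>p. prod_encode (p, encode_interval (bnds' p))) ` params B"
    using eq fin[OF A] fin[OF B]
    by (simp_all add: list_encode_eq set_encode_eq del: list_encode.simps cong: conj_cong)
  have "edges A = edges B"
    using inj_on_image_eq_iff[OF inj_on_encode_edge sub[OF A] sub[OF B]] ed by simp
  moreover have "bnds p = bnds' p" if "p \<in> params A" for p
  proof -
    have "prod_encode (p, encode_interval (bnds p)) \<in>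
        (\<lambda>p. prod_encode (p, encode_interval (bnds' p))) ` params B"
      using that bd by blast
    then show ?thesis by (auto simp: encode_interval_eq)
  qed
  ultimately show ?thesis using base by simp
qed

lemma computes_unique: "computes f xs y \<Longrightarrow> computes f xs z \<Longrightarrow> y = z"
proof (induction arbitrary: z rule: computes.induct)
  case (1 xs)
  then show ?case by cases auto
next
  case (2 x)
  then show ?case by cases auto
next
  case (3 i xs)
  from "3.prems" show ?case by cases auto
next
  case (4 xs gs ys f y)
  from "4.prems" obtain ys' where ys': "list_all2 (\<lambda>g y. computes g xs y) gs ys'"
    and f: "computes f ys' z"
    by cases auto
  have "ys = ys'"
  proof (rule nth_equalityI)
    show "length ys = length ys'" using "4.IH"(1) ys' by (auto dest!: list_all2_lengthD)
    fix i assume "i < length ys"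
    then show "ys ! i = ys' ! i"
      using "4.IH"(1) ys' by (auto simp: list_all2_conv_all_nth)
  qed
  then show ?case using "4.IH"(2) f by blast
next
  case (5 f xs y g)
  from "5.prems" show ?case by cases (auto intro: "5.IH")
next
  case (6 f g n xs r y)
  from "6.prems" obtain r' where "computes (PrimRec f g) (n # xs) r'" "computes g (n # r' # xs) z"
    by cases auto
  then show ?case using "6.IH" by blast
next
  case (7 f n xs)
  from "7.prems" have z: "computes f (z # xs) 0" and lt: "\<forall>k < z. \<exists>y. computes f (k # xs) (Suc y)"
    by (cases; simp)+
  show ?case
  proof (rule linorder_cases[of n z])
    assume "n < z"
    then obtain y where "computes f (n # xs) (Suc y)" using lt by blast
    then show ?thesis using "7.IH"(1) by blast
  next
    assume "z < n"
    then show ?thesis using "7.IH"(2) z by blast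
  qed
qed

end

theory Submission
  imports Defs
begin

text \<open>
  The halting problem for counter programs reduces to the problem. One process, the controller, runs
  the program in cycles, and the other processes represent the counters in unary. The clique semantics
  allows exact increments and decrements, but a test for zero can only be done by discarding all
  processes of the counter, so a wrong answer costs at least one process. The single parameter \<open>p\<close> is an
  upper bound ranging over \<open>(0, 1]\<close>: each cycle must end within time \<open>p\<close>, whereas the target is reached
  only after total time 1. Hence about \<open>1 / p\<close> cycles are needed. If the program halts, a sufficiently
  large network performs any number of faithful cycles. If it does not, every cycle loses a process,
  so a network of size \<open>N\<close> fails for \<open>p = 1 / (N + 1)\<close>.

  For undecidability one diagonalizes. Given a decision procedure \<open>f\<close>, a counter program computes, from
  the code \<open>d\<close> of its own protocol, the code of the instance that runs it on input \<open>d\<close>, and halts iff \<open>f\<close>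
  rejects this instance. The input is loaded by a chain of \<open>d\<close> additional states, which are not part of
  the edges coded by \<open>d\<close>; so the code of the whole instance is a recursive function of \<open>d\<close>.
\<close>

section \<open>Counter programs and their control graphs\<close>

text \<open>One clock per process is enough because the two durations are kept by different
  processes: the controller's clock is reset in every cycle, while the workers' clocks are never
  reset and show the total time. As \<open>N\<close> is chosen before \<open>p\<close>, one size has
  to serve for arbitrarily many cycles; as 0 is excluded from the interval, each single
  \<open>p\<close> needs only finitely many. The obstacle in the diagonalization is that the map to
  codes of instances must be shown recursive. Inserting the input into the program text would
  require arithmetic on coded programs. With a chain of control states instead, everything that
  depends on the program is hidden in the single number \<open>d\<close>, and only sums of powers of
  two and pairings remain. The same \<open>d\<close> is the input, the length of the chain and the
  offset of its state names: a set code exceeds each element and an edge code is at least each state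
  in it, so names from \<open>d\<close> on are fresh.\<close>

datatype instr = Skip | Inc nat | Dec nat | IfZero nat

type_synonym store = "nat \<Rightarrow> nat"

fun exec :: "instr \<Rightarrow> store \<Rightarrow> store \<Rightarrow> bool" where
  "exec Skip s s' \<longleftrightarrow> s' = s"
| "exec (Inc r) s s' \<longleftrightarrow> s' = s(r := Suc (s r))"
| "exec (Dec r) s s' \<longleftrightarrow> s r > 0 \<and> s' = s(r := s r - 1)"
| "exec (IfZero r) s s' \<longleftrightarrow> s r = 0 \<and> s' = s"

type_synonym 'q graph = "('q \<times> instr \<times> 'q) set"

definition gstep :: "'q graph \<Rightarrow> 'q \<times> store \<Rightarrow> 'q \<times> store \<Rightarrow> bool" where
  "gstep T a b \<longleftrightarrow> (\<exists>\<alpha>. (fst a, \<alpha>, fst b) \<in> T \<and> exec \<alpha> (snd a) (snd b))"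

datatype prog = Atom instr | Seq prog prog | Loop prog

text \<open>Relational, since \<open>Loop\<close> may be left at any time. Wrong guesses get stuck
  at a \<open>Dec\<close> or an \<open>IfZero\<close>, and a stuck or endless run is just the
  absence of a final store.\<close>

fun sem :: "prog \<Rightarrow> (store \<times> store) set" where
  "sem (Atom \<alpha>) = {(s, s'). exec \<alpha> s s'}"
| "sem (Seq a b) = sem a O sem b"
| "sem (Loop a) = (sem a)\<^sup>*"

text \<open>Control points of a program are its continuations, i.e. lists of programs still to be run.\<close>

fun succs :: "prog list \<Rightarrow> (instr \<times> prog list) set" where
  "succs [] = {}"
| "succs (Atom \<alpha> # k) = {(\<alpha>, k)}"
| "succs (Seq a b # k) = {(Skip, a # b # k)}"
| "succs (Loop a # k) = {(Skip, k), (Skip, a # Loop a # k)}"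

text \<open>A loop body continues with the loop itself, so only finitely many lists arise. The final
  continuation \<open>k\<close> is left out; for a whole program it is \<open>[]\<close>, the
  halting point.\<close>

fun conts :: "prog \<Rightarrow> prog list \<Rightarrow> prog list set" where
  "conts (Atom \<alpha>) k = {Atom \<alpha> # k}"
| "conts (Seq a b) k = {Seq a b # k} \<union> conts a (b # k) \<union> conts b k"
| "conts (Loop a) k = {Loop a # k} \<union> conts a (Loop a # k)"

fun instr_regs :: "instr \<Rightarrow> nat set" where
  "instr_regs Skip = {}"
| "instr_regs (Inc r) = {r}"
| "instr_regs (Dec r) = {r}"
| "instr_regs (IfZero r) = {r}"

fun regs :: "prog \<Rightarrow> nat set" where
  "regs (Atom \<alpha>) = instr_regs \<alpha>"
| "regs (Seq a b) = regs a \<union> regs b"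
| "regs (Loop a) = regs a"

definition cont_graph :: "prog \<Rightarrow> prog list graph" where
  "cont_graph c = {(k, \<alpha>, k'). k \<in> conts c [] \<and> (\<alpha>, k') \<in> succs k}"

lemma cont_self: "c # k \<in> conts c k"
  by (cases c) auto

lemma conts_closed: "l \<in> conts c k \<Longrightarrow> (\<alpha>, l') \<in> succs l \<Longrightarrow> l' \<in> conts c k \<or> l' = k"
proof (induction c arbitrary: k)
  case (Seq a b)
  then show ?case using cont_self[of a "b # k"] cont_self[of b k] by fastforce
next
  case (Loop a)
  then show ?case using cont_self[of a "Loop a # k"] by fastforce
qed auto

lemma finite_conts: "finite (conts c k)"
  by (induction c arbitrary: k) auto

lemma finite_regs: "finite (regs c)"
proof (induction c)
  case (Atom \<alpha>)
  show ?case by (cases \<alpha>) auto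
qed auto

lemma finite_succs: "finite (succs k)"
  by (cases k rule: succs.cases) auto

lemma finite_cont_graph: "finite (cont_graph c)"
proof -
  have "cont_graph c = (SIGMA k : conts c []. succs k)"
    by (auto simp: cont_graph_def)
  then show ?thesis using finite_conts finite_succs by (metis finite_SigmaI)
qed

lemma conts_regs:
  assumes "l \<in> conts c k" "(\<alpha>, l') \<in> succs l"
  shows "instr_regs \<alpha> \<subseteq> regs c"
  using assms
proof (induction c arbitrary: k)
  case (Seq a b)
  then show ?case by fastforce
next
  case (Loop a)
  then show ?case by fastforce
qed auto

fun sem_cont :: "prog list \<Rightarrow> (store \<times> store) set" where
  "sem_cont [] = Id"
| "sem_cont (c # k) = sem c O sem_cont k"

text \<open>One edge peels off one factor of the meaning of a continuation; for \<open>Loop\<close>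
  the two successors are the two ways to unfold a reflexive transitive closure.\<close>

lemma sem_cont_step:
  assumes "(\<alpha>, k') \<in> succs k" "exec \<alpha> s s'" "(s', t) \<in> sem_cont k'"
  shows "(s, t) \<in> sem_cont k"
  using assms by (cases k rule: succs.cases)
    (auto intro: relcompI relcompI[OF converse_rtrancl_into_rtrancl])

lemma cont_graph_sound:
  assumes "(gstep (cont_graph c))\<^sup>*\<^sup>* (k, s) (k', s')" "(s', t) \<in> sem_cont k'"
  shows "(s, t) \<in> sem_cont k"
  using assms
  by (induction "(k, s)" arbitrary: k s rule: converse_rtranclp_induct)
    (auto simp: gstep_def cont_graph_def intro: sem_cont_step)

text \<open>The continuation \<open>k\<close> is arbitrary because subprograms run in front of the
  rest of the program; the second assumption places their control points in the graph of
  \<open>c\<close>.\<close>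

lemma cont_graph_complete:
  assumes "(s, s') \<in> sem p" "conts p k \<subseteq> conts c []"
  shows "(gstep (cont_graph c))\<^sup>*\<^sup>* (p # k, s) (k, s')"
  using assms
proof (induction p arbitrary: k s s')
  case (Atom \<alpha>)
  then have "gstep (cont_graph c) (Atom \<alpha> # k, s) (k, s')"
    by (auto simp: gstep_def cont_graph_def)
  then show ?case by blast
next
  case (Seq a b)
  then obtain u where u: "(s, u) \<in> sem a" "(u, s') \<in> sem b" by auto
  have "gstep (cont_graph c) (Seq a b # k, s) (a # b # k, s)"
    using Seq.prems by (auto simp: gstep_def cont_graph_def)
  also have "(gstep (cont_graph c))\<^sup>*\<^sup>* (a # b # k, s) (b # k, u)"
    using Seq u by auto
  also have "(gstep (cont_graph c))\<^sup>*\<^sup>* (b # k, u) (k, s')"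
    using Seq u by auto
  finally show ?case by simp
next
  case (Loop a)
  have "(s, s') \<in> (sem a)\<^sup>*" using Loop by simp
  then show ?case
  proof (induction rule: converse_rtrancl_induct)
    case base
    have "gstep (cont_graph c) (Loop a # k, s') (k, s')"
      using Loop.prems by (auto simp: gstep_def cont_graph_def)
    then show ?case by blast
  next
    case (step s u)
    have "gstep (cont_graph c) (Loop a # k, s) (a # Loop a # k, s)"
      using Loop.prems by (auto simp: gstep_def cont_graph_def)
    also have "(gstep (cont_graph c))\<^sup>*\<^sup>* (a # Loop a # k, s) (Loop a # k, u)"
      using Loop step by auto
    also have "(gstep (cont_graph c))\<^sup>*\<^sup>* (Loop a # k, u) (k, s')" by fact
    finally show ?case by simp
  qed
qed

theorem cont_graph_correct:
  "(gstep (cont_graph c))\<^sup>*\<^sup>* ([c], s) ([], s') \<longleftrightarrow> (s, s') \<in> sem c"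
  using cont_graph_sound[of c "[c]" s "[]" s' s'] cont_graph_complete[of s s' c "[]" c] by auto

section \<open>Compiling recursive functions to counter programs\<close>

definition clear :: "nat \<Rightarrow> prog" where
  "clear a = Seq (Loop (Atom (Dec a))) (Atom (IfZero a))"

definition move :: "nat \<Rightarrow> nat \<Rightarrow> prog" where
  "move a b = Seq (Loop (Seq (Atom (Dec a)) (Atom (Inc b)))) (Atom (IfZero a))"

text \<open>Reading a counter empties it, so its value goes to \<open>b\<close> and \<open>t\<close>
  in parallel and is restored from \<open>t\<close>.\<close>

definition copy :: "nat \<Rightarrow> nat \<Rightarrow> nat \<Rightarrow> prog" where
  "copy a b t =
     Seq (Seq (Loop (Seq (Atom (Dec a)) (Seq (Atom (Inc b)) (Atom (Inc t))))) (Atom (IfZero a)))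
         (move t a)"

text \<open>Stands for an application to the wrong number of arguments, where no value is
  computed.\<close>

definition fail :: prog where
  "fail = Seq (Atom (Inc 0)) (Atom (IfZero 0))"

fun clears :: "nat list \<Rightarrow> prog" where
  "clears [] = Atom Skip"
| "clears (r # rs) = Seq (clear r) (clears rs)"

text \<open>The loop may be left at any time, but \<open>IfZero a\<close> blocks an early exit and
  the body blocks once \<open>a\<close> is empty. As each round decreases \<open>a\<close> and
  leaves the value of \<open>G\<close> unchanged, the whole program is the function
  \<open>G\<close>.\<close>

lemma sem_drain:
  assumes body: "\<And>s s'. (s, s') \<in> sem c \<longleftrightarrow> s a > 0 \<and> s' = g s"
    and dec: "\<And>s. s a > 0 \<Longrightarrow> g s a < s a"
    and G0: "\<And>s. s a = 0 \<Longrightarrow> G s = s"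
    and G1: "\<And>s. s a > 0 \<Longrightarrow> G (g s) = G s"
  shows "(s, s') \<in> sem (Seq (Loop c) (Atom (IfZero a))) \<longleftrightarrow> s' = G s"
proof (induction "s a" arbitrary: s rule: less_induct)
  case less
  have iff: "(s, s') \<in> sem (Seq (Loop c) (Atom (IfZero a))) \<longleftrightarrow> (s, s') \<in> (sem c)\<^sup>* \<and> s' a = 0" for s
    by auto
  show ?case
  proof (cases "s a = 0")
    case True
    then show ?thesis unfolding iff using body by (auto simp: G0 elim: converse_rtranclE)
  next
    case False
    then have "(s, s') \<in> (sem c)\<^sup>* \<and> s' a = 0 \<longleftrightarrow> (g s, s') \<in> (sem c)\<^sup>* \<and> s' a = 0"
      using body by (auto elim: converse_rtranclE intro: converse_rtrancl_into_rtrancl)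
    also have "\<dots> \<longleftrightarrow> s' = G (g s)"
      using less[of "g s"] dec False unfolding iff by simp
    finally show ?thesis unfolding iff using False G1 by simp
  qed
qed

lemma sem_clear: "(s, s') \<in> sem (clear a) \<longleftrightarrow> s' = s(a := 0)"
  unfolding clear_def by (rule sem_drain[where g = "\<lambda>s. s(a := s a - 1)" and G = "\<lambda>s. s(a := 0)"]) auto

lemma sem_move:
  "a \<noteq> b \<Longrightarrow> (s, s') \<in> sem (move a b) \<longleftrightarrow> s' = s(a := 0, b := s b + s a)"
  unfolding move_def
  by (rule sem_drain[where g = "\<lambda>s. s(a := s a - 1, b := Suc (s b))"
      and G = "\<lambda>s. s(a := 0, b := s b + s a)"])
    (auto simp: relcomp_unfold)

lemma sem_copy:
  assumes "a \<noteq> b" "a \<noteq> t" "b \<noteq> t" "s t = 0"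
  shows "(s, s') \<in> sem (copy a b t) \<longleftrightarrow> s' = s(b := s b + s a)"
proof -
  have "(s, u) \<in> sem (Seq (Loop (Seq (Atom (Dec a)) (Seq (Atom (Inc b)) (Atom (Inc t)))))
      (Atom (IfZero a))) \<longleftrightarrow> u = s(a := 0, b := s b + s a, t := s t + s a)" for u
    by (rule sem_drain[where g = "\<lambda>s. s(a := s a - 1, b := Suc (s b), t := Suc (s t))"
        and G = "\<lambda>s. s(a := 0, b := s b + s a, t := s t + s a)"])
      (use assms(1-3) in \<open>auto simp: relcomp_unfold fun_upd_twist\<close>)
  then have "(s, s') \<in> sem (copy a b t) \<longleftrightarrow>
      (s(a := 0, b := s b + s a, t := s t + s a), s') \<in> sem (move t a)"
    unfolding copy_def by (subst sem.simps) (auto simp del: sem.simps)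
  also have "\<dots> \<longleftrightarrow> s' = s(b := s b + s a)"
    using assms by (subst sem_move) (auto simp: fun_upd_twist)
  finally show ?thesis .
qed

lemma sem_fail: "sem fail = {}"
  by (auto simp: fail_def)

lemma sem_clears:
  "(s, s') \<in> sem (clears rs) \<longleftrightarrow> s' = (\<lambda>r. if r \<in> set rs then 0 else s r)"
proof (induction rs arbitrary: s)
  case (Cons r rs)
  have "(s, s') \<in> sem (clears (r # rs)) \<longleftrightarrow> (s(r := 0), s') \<in> sem (clears rs)"
    by (auto simp: sem_clear relcomp_unfold)
  also have "\<dots> \<longleftrightarrow> s' = (\<lambda>q. if q \<in> set (r # rs) then 0 else s q)"
    unfolding Cons by (intro arg_cong2[where f = "(=)"]) auto
  finally show ?case .
qed auto

text \<open>The program \<open>comp f ins out m\<close> adds to the empty register \<open>out\<close> the value of \<open>f\<close> at the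
  contents of \<open>ins\<close>; the registers from \<open>m\<close> on are scratch space, empty before and after.\<close>

fun comp :: "recf \<Rightarrow> nat list \<Rightarrow> nat \<Rightarrow> nat \<Rightarrow> prog"
  and comps :: "recf list \<Rightarrow> nat list \<Rightarrow> nat \<Rightarrow> nat \<Rightarrow> prog" where
  "comp Zero ins out m = Atom Skip"
| "comp Succ ins out m = (case ins of [x] \<Rightarrow> Seq (copy x out m) (Atom (Inc out)) | _ \<Rightarrow> fail)"
| "comp (Proj i) ins out m = (if i < length ins then copy (ins ! i) out m else fail)"
| "comp (Comp f gs) ins out m =
     Seq (comps gs ins m (m + length gs))
    (Seq (comp f [m..<m + length gs] out (m + length gs))
         (clears [m..<m + length gs]))"
| "comp (PrimRec f g) ins out m = (case ins of [] \<Rightarrow> fail | n # ins' \<Rightarrow>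
     Seq (copy n (m + 1) (m + 2))
    (Seq (comp f ins' out (m + 3))
    (Seq (Loop
      (Seq (Atom (Dec (m + 1)))
      (Seq (comp g (m # out # ins') (m + 2) (m + 3))
      (Seq (clear out)
      (Seq (move (m + 2) out)
           (Atom (Inc m)))))))
    (Seq (Atom (IfZero (m + 1)))
         (clear m)))))"
| "comp (Mu f) ins out m =
     Seq (Loop
      (Seq (comp f (m # ins) (m + 1) (m + 2))
      (Seq (Atom (Dec (m + 1)))
      (Seq (clear (m + 1))
           (Atom (Inc m))))))
    (Seq (comp f (m # ins) (m + 1) (m + 2))
    (Seq (Atom (IfZero (m + 1)))
         (move m out)))"
| "comps [] ins j m = Atom Skip"
| "comps (g # gs) ins j m = Seq (comp g ins j m) (comps gs ins (Suc j) m)"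

fun put :: "store \<Rightarrow> nat \<Rightarrow> nat list \<Rightarrow> store" where
  "put s j [] = s"
| "put s j (y # ys) = put (s(j := y)) (Suc j) ys"

lemma put_less: "r < j \<Longrightarrow> put s j ys r = s r"
  by (induction ys arbitrary: s j) auto

lemma put_geq: "j + length ys \<le> r \<Longrightarrow> put s j ys r = s r"
  by (induction ys arbitrary: s j) auto

lemma map_put: "map (put s j ys) [j..<j + length ys] = ys"
proof (induction ys arbitrary: s j)
  case (Cons y ys)
  have "map (put s j (y # ys)) (j # [Suc j..<Suc j + length ys]) = y # ys"
    using Cons[of "s(j := y)" "Suc j"] by (simp add: put_less del: upt_Suc fun_upd_apply)
      (simp add: fun_upd_same)
  moreover have "[j..<j + length (y # ys)] = j # [Suc j..<Suc j + length ys]"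
    using upt_conv_Cons[of j "j + length (y # ys)"] by (simp del: upt_Suc)
  ultimately show ?case by (simp only:)
qed simp

section \<open>Correctness of the compiler\<close>

inductive_cases computes_ZeroE: "computes Zero xs y"
inductive_cases computes_SuccE: "computes Succ xs y"
inductive_cases computes_ProjE: "computes (Proj i) xs y"
inductive_cases computes_CompE: "computes (Comp f gs) xs y"
inductive_cases computes_PrimRec_NilE: "computes (PrimRec f g) [] y"
inductive_cases computes_PrimRec_0E: "computes (PrimRec f g) (0 # xs) y"
inductive_cases computes_PrimRec_SucE: "computes (PrimRec f g) (Suc n # xs) y"
inductive_cases computes_MuE: "computes (Mu f) xs y"

lemma computes_Zero_iff: "computes Zero xs y \<longleftrightarrow> y = 0"
  by (auto intro: computes.intros elim: computes_ZeroE)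

lemma computes_Succ_iff: "computes Succ xs y \<longleftrightarrow> (\<exists>x. xs = [x] \<and> y = Suc x)"
  by (auto intro: computes.intros elim: computes_SuccE)

lemma computes_Proj_iff: "computes (Proj i) xs y \<longleftrightarrow> i < length xs \<and> y = xs ! i"
  by (auto intro: computes.intros elim: computes_ProjE)

lemma computes_Comp_iff: "computes (Comp f gs) xs y \<longleftrightarrow>
    (\<exists>ys. list_all2 (\<lambda>g y. computes g xs y) gs ys \<and> computes f ys y)"
  by (auto intro: computes.intros elim: computes_CompE)

lemma computes_PrimRec_0_iff: "computes (PrimRec f g) (0 # xs) y \<longleftrightarrow> computes f xs y"
  by (auto intro: computes.intros elim: computes_PrimRec_0E)

lemma computes_PrimRec_Suc_iff: "computes (PrimRec f g) (Suc n # xs) y \<longleftrightarrow>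
    (\<exists>r. computes (PrimRec f g) (n # xs) r \<and> computes g (n # r # xs) y)"
  by (auto intro: computes.intros elim: computes_PrimRec_SucE)

lemma computes_Mu_iff: "computes (Mu f) xs n \<longleftrightarrow>
    computes f (n # xs) 0 \<and> (\<forall>k < n. \<exists>y. computes f (k # xs) (Suc y))"
  by (auto intro: computes.intros elim: computes_MuE)

text \<open>An equivalence, because where \<open>f\<close> is undefined the program must have no
  terminating run. \<open>out\<close> is kept apart from \<open>ins\<close> because the recursion
  overwrites \<open>out\<close> while it still reads its arguments.\<close>

definition comp_ok :: "recf \<Rightarrow> bool" where
  "comp_ok f \<longleftrightarrow> (\<forall>ins out m s s'. set ins \<subseteq> {..<m} \<longrightarrow> out < m \<longrightarrow> out \<notin> set ins \<longrightarrow> s out = 0 \<longrightarrow>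
      (\<forall>r\<ge>m. s r = 0) \<longrightarrow>
      ((s, s') \<in> sem (comp f ins out m) \<longleftrightarrow> (\<exists>y. computes f (map s ins) y \<and> s' = s(out := y))))"

lemma comp_okD:
  "comp_ok f \<Longrightarrow> set ins \<subseteq> {..<m} \<Longrightarrow> out < m \<Longrightarrow> out \<notin> set ins \<Longrightarrow> s out = 0 \<Longrightarrow>
    \<forall>r\<ge>m. s r = 0 \<Longrightarrow>
    (s, s') \<in> sem (comp f ins out m) \<longleftrightarrow> (\<exists>y. computes f (map s ins) y \<and> s' = s(out := y))"
  unfolding comp_ok_def by blast

text \<open>The store at the head of the recursion loop: \<open>i\<close> rounds done,
  \<open>d\<close> to go, value \<open>r\<close> so far.\<close>

definition prim_store :: "store \<Rightarrow> nat \<Rightarrow> nat \<Rightarrow> nat \<Rightarrow> nat \<Rightarrow> nat \<Rightarrow> store" where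
  "prim_store s m out i d r = s(m := i, m + 1 := d, out := r)"

text \<open>At the loop head, \<open>out\<close> holds the value of the recursion at the number of
  rounds done; the test of \<open>m + 1\<close> then forces exactly \<open>s n\<close>
  rounds.\<close>

lemma comp_PrimRec_correct:
  assumes f: "comp_ok f"
    and g: "comp_ok g"
    and prem: "set (n # ins) \<subseteq> {..<m}" "out < m" "out \<notin> set (n # ins)" "s out = 0" "\<forall>r\<ge>m. s r = 0"
  shows "(s, s') \<in> sem (comp (PrimRec f g) (n # ins) out m) \<longleftrightarrow>
    (\<exists>y. computes (PrimRec f g) (map s (n # ins)) y \<and> s' = s(out := y))"
proof -
  define xs where "xs = map s ins"
  let ?st = "prim_store s m out"
  define body where "body = sem (Seq (Atom (Dec (m + 1)))
      (Seq (comp g (m # out # ins) (m + 2) (m + 3))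
      (Seq (clear out) (Seq (move (m + 2) out) (Atom (Inc m))))))"
  have map_st: "map (?st i d r) ins = xs" for i d r
    unfolding xs_def prim_store_def using prem by auto
  have body: "(?st i d r, u) \<in> body \<longleftrightarrow>
      d > 0 \<and> (\<exists>y. computes g (i # r # xs) y \<and> u = ?st (Suc i) (d - 1) y)" for i d r u
  proof -
    have upd: "(?st i d r)(m + 1 := d - 1) = ?st i (d - 1) r"
      using prem by (auto simp: prim_store_def fun_eq_iff)
    have c: "(?st i (d - 1) r, v) \<in> sem (comp g (m # out # ins) (m + 2) (m + 3)) \<longleftrightarrow>
       (\<exists>y. computes g (i # r # xs) y \<and> v = (?st i (d - 1) r)(m + 2 := y))" for v
    proof -
      have "(?st i (d - 1) r, v) \<in> sem (comp g (m # out # ins) (m + 2) (m + 3)) \<longleftrightarrow>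
         (\<exists>y. computes g (map (?st i (d - 1) r) (m # out # ins)) y \<and> v = (?st i (d - 1) r)(m + 2 := y))"
        by (rule comp_okD[OF g]) (use prem in \<open>auto simp: prim_store_def\<close>)
      moreover have "map (?st i (d - 1) r) (m # out # ins) = i # r # xs"
        using map_st prem by (auto simp: prim_store_def)
      ultimately show ?thesis by simp
    qed
    \<comment> \<open>The next value was computed into \<open>m + 2\<close> because \<open>g\<close>
      reads the current one from \<open>out\<close>; now it replaces the current one, and the round
      counter advances.\<close>
    have e: "w(m + 2 := 0, out := w out + w (m + 2), m := Suc (w m)) = ?st (Suc i) (d - 1) y"
      if "w = (?st i (d - 1) r)(m + 2 := y, out := 0)" for w y
      using that prem by (auto simp: prim_store_def fun_eq_iff)
    have d: "?st i d r (m + 1) = d" using prem by (auto simp: prim_store_def)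
    have mv: "(w, u) \<in> sem (Seq (move (m + 2) out) (Atom (Inc m))) \<longleftrightarrow>
        u = w(m + 2 := 0, out := w out + w (m + 2), m := Suc (w m))" for w
      using prem sem_move[of "m + 2" out] by (auto simp: relcomp_unfold)
    have "(?st i d r, u) \<in> body \<longleftrightarrow> d > 0 \<and>
        (\<exists>v. ((?st i d r)(m + 1 := d - 1), v) \<in> sem (comp g (m # out # ins) (m + 2) (m + 3)) \<and>
          (v(out := 0), u) \<in> sem (Seq (move (m + 2) out) (Atom (Inc m))))"
      unfolding body_def using d by (subst sem.simps)+ (auto simp: relcomp_unfold sem_clear simp del: sem.simps(2))
    also have "\<dots> \<longleftrightarrow> d > 0 \<and> (\<exists>y. computes g (i # r # xs) y \<and>
          (((?st i (d - 1) r)(m + 2 := y))(out := 0), u) \<in> sem (Seq (move (m + 2) out) (Atom (Inc m))))"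
      unfolding upd c by blast
    also have "\<dots> \<longleftrightarrow> d > 0 \<and> (\<exists>y. computes g (i # r # xs) y \<and> u = ?st (Suc i) (d - 1) y)"
      unfolding mv using e[OF refl] prem by simp
    finally show ?thesis .
  qed
  have sound: "\<exists>i y. i \<le> s n \<and> computes (PrimRec f g) (i # xs) y \<and> u = ?st i (s n - i) y"
    if "(?st 0 (s n) r0, u) \<in> body\<^sup>*" "computes f xs r0" for u r0
    using that
  proof (induction rule: rtrancl_induct)
    case base
    then show ?case by (intro exI[of _ 0] exI[of _ r0]) (auto simp: computes_PrimRec_0_iff)
  next
    case (step u v)
    then obtain i y where i: "i \<le> s n" "computes (PrimRec f g) (i # xs) y" "u = ?st i (s n - i) y"
      by blast
    have "(?st i (s n - i) y, v) \<in> body" using step i by simp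
    then obtain z where "s n - i > 0" "computes g (i # y # xs) z"
      "v = ?st (Suc i) (s n - i - 1) z" unfolding body by blast
    with i show ?case
      by (intro exI[of _ "Suc i"] exI[of _ z]) (auto simp: computes_PrimRec_Suc_iff)
  qed
  have complete: "i \<le> s n \<Longrightarrow> computes (PrimRec f g) (i # xs) y \<Longrightarrow>
      \<exists>r0. computes f xs r0 \<and> (?st 0 (s n) r0, ?st i (s n - i) y) \<in> body\<^sup>*" for i y
  proof (induction i arbitrary: y)
    case (Suc i)
    then obtain r where r: "computes (PrimRec f g) (i # xs) r" "computes g (i # r # xs) y"
      by (auto simp: computes_PrimRec_Suc_iff)
    with Suc obtain r0 where r0: "computes f xs r0" "(?st 0 (s n) r0, ?st i (s n - i) r) \<in> body\<^sup>*"
      by auto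
    have "(?st i (s n - i) r, ?st (Suc i) (s n - Suc i) y) \<in> body"
      using body r Suc.prems by auto
    with r0 show ?case by (meson rtrancl.rtrancl_into_rtrancl)
  qed (auto simp: computes_PrimRec_0_iff)
  have copy: "(s, u) \<in> sem (copy n (m + 1) (m + 2)) \<longleftrightarrow> u = s(m + 1 := s n)" for u
    using prem by (subst sem_copy) auto
  have init: "(s(m + 1 := s n), u) \<in> sem (comp f ins out (m + 3)) \<longleftrightarrow>
      (\<exists>r0. computes f xs r0 \<and> u = ?st 0 (s n) r0)" for u
  proof -
    have "(s(m + 1 := s n), u) \<in> sem (comp f ins out (m + 3)) \<longleftrightarrow>
       (\<exists>y. computes f (map (s(m + 1 := s n)) ins) y \<and> u = (s(m + 1 := s n))(out := y))"
      by (rule comp_okD[OF f]) (use prem in auto)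
    moreover have "map (s(m + 1 := s n)) ins = xs" using prem by (auto simp: xs_def)
    moreover have "(s(m + 1 := s n))(out := y) = ?st 0 (s n) y" for y
      using prem by (auto simp: prim_store_def fun_eq_iff)
    ultimately show ?thesis by simp
  qed
  have "(s, s') \<in> sem (comp (PrimRec f g) (n # ins) out m) \<longleftrightarrow>
     (\<exists>r0 u. computes f xs r0 \<and> (?st 0 (s n) r0, u) \<in> body\<^sup>* \<and> u (m + 1) = 0 \<and> s' = u(m := 0))"
    using copy init unfolding body_def by (auto simp: relcomp_unfold sem_clear)
  also have "\<dots> \<longleftrightarrow> (\<exists>y. computes (PrimRec f g) (s n # xs) y \<and> s' = (?st (s n) 0 y)(m := 0))"
  proof safe
    fix r0 u
    assume "computes f xs r0" "(?st 0 (s n) r0, u) \<in> body\<^sup>*" and u: "u (m + 1) = 0"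
    with sound obtain i y where i: "i \<le> s n" "computes (PrimRec f g) (i # xs) y"
      "u = ?st i (s n - i) y" by blast
    with u prem have "i = s n" by (auto simp: prim_store_def split: if_splits)
    with i show "\<exists>y. computes (PrimRec f g) (s n # xs) y \<and> u(m := 0) = (?st (s n) 0 y)(m := 0)"
      by auto
  next
    fix y assume "computes (PrimRec f g) (s n # xs) y"
    with complete[of "s n" y] obtain r0 where "computes f xs r0"
      "(?st 0 (s n) r0, ?st (s n) 0 y) \<in> body\<^sup>*" by auto
    moreover have "?st (s n) 0 y (m + 1) = 0" using prem by (auto simp: prim_store_def)
    ultimately show "\<exists>r0 u. computes f xs r0 \<and> (?st 0 (s n) r0, u) \<in> body\<^sup>* \<and> u (m + 1) = 0 \<and>
        (?st (s n) 0 y)(m := 0) = u(m := 0)" by blast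
  qed
  also have "\<dots> \<longleftrightarrow> (\<exists>y. computes (PrimRec f g) (map s (n # ins)) y \<and> s' = s(out := y))"
  proof -
    have "(?st (s n) 0 y)(m := 0) = s(out := y)" for y
      using prem by (auto simp: prim_store_def fun_eq_iff)
    then show ?thesis by (simp add: xs_def)
  qed
  finally show ?thesis .
qed

text \<open>The guess whether to go on searching is checked: a round passes
  \<open>Dec (m + 1)\<close> only if the value at the current candidate is positive, the exit passes
  \<open>IfZero (m + 1)\<close> only if it is zero. So the exit is at the least zero, all earlier
  values being defined.\<close>

lemma comp_Mu_correct:
  assumes f: "comp_ok f"
    and prem: "set ins \<subseteq> {..<m}" "out < m" "out \<notin> set ins" "s out = 0" "\<forall>r\<ge>m. s r = 0"
  shows "(s, s') \<in> sem (comp (Mu f) ins out m) \<longleftrightarrow>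
    (\<exists>y. computes (Mu f) (map s ins) y \<and> s' = s(out := y))"
proof -
  define xs where "xs = map s ins"
  let ?st = "\<lambda>i. s(m := i)"
  define body where "body = sem (Seq (comp f (m # ins) (m + 1) (m + 2))
      (Seq (Atom (Dec (m + 1))) (Seq (clear (m + 1)) (Atom (Inc m)))))"
  have c: "(?st i, u) \<in> sem (comp f (m # ins) (m + 1) (m + 2)) \<longleftrightarrow>
      (\<exists>y. computes f (i # xs) y \<and> u = (?st i)(m + 1 := y))" for i u
  proof -
    have "(?st i, u) \<in> sem (comp f (m # ins) (m + 1) (m + 2)) \<longleftrightarrow>
       (\<exists>y. computes f (map (?st i) (m # ins)) y \<and> u = (?st i)(m + 1 := y))"
      by (rule comp_okD[OF f]) (use prem in auto)
    moreover have "map (?st i) (m # ins) = i # xs" using prem by (auto simp: xs_def)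
    ultimately show ?thesis by simp
  qed
  have body: "(?st i, u) \<in> body \<longleftrightarrow> (\<exists>y. computes f (i # xs) (Suc y)) \<and> u = ?st (Suc i)" for i u
  proof -
    have e: "((?st i)(m + 1 := 0))(m := Suc i) = ?st (Suc i)"
      using prem by (auto simp: fun_eq_iff)
    have "(?st i, u) \<in> body \<longleftrightarrow> (\<exists>y. computes f (i # xs) y \<and> 0 < y \<and>
       u = ((?st i)(m + 1 := 0))(m := Suc i))"
      unfolding body_def using c by (auto simp: relcomp_unfold sem_clear)
    then show ?thesis unfolding e by (auto simp: gr0_conv_Suc)
  qed
  have st0: "?st 0 = s" using prem by (auto simp: fun_eq_iff)
  have loop: "(s, u) \<in> body\<^sup>* \<longleftrightarrow>
      (\<exists>i. (\<forall>k<i. \<exists>y. computes f (k # xs) (Suc y)) \<and> u = ?st i)" for u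
  proof
    assume "(s, u) \<in> body\<^sup>*"
    then show "\<exists>i. (\<forall>k<i. \<exists>y. computes f (k # xs) (Suc y)) \<and> u = ?st i"
    proof (induction rule: rtrancl_induct)
      case base
      show ?case using st0 by (intro exI[of _ 0]) auto
    next
      case (step u v)
      then obtain i where "\<forall>k<i. \<exists>y. computes f (k # xs) (Suc y)" "u = ?st i" by blast
      with step body show ?case by (intro exI[of _ "Suc i"]) (auto simp: less_Suc_eq)
    qed
  next
    have "(\<forall>k<i. \<exists>y. computes f (k # xs) (Suc y)) \<Longrightarrow> (s, ?st i) \<in> body\<^sup>*" for i
    proof (induction i)
      case 0
      then show ?case using st0 by (simp del: fun_upd_apply)
    next
      case (Suc i)
      then have "(?st i, ?st (Suc i)) \<in> body" using body by blast
      with Suc show ?case by (meson less_SucI rtrancl.rtrancl_into_rtrancl)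
    qed
    then show "(s, u) \<in> body\<^sup>*"
      if "\<exists>i. (\<forall>k<i. \<exists>y. computes f (k # xs) (Suc y)) \<and> u = ?st i"
      using that by blast
  qed
  have fin: "(?st i, s') \<in> sem (Seq (comp f (m # ins) (m + 1) (m + 2))
      (Seq (Atom (IfZero (m + 1))) (move m out))) \<longleftrightarrow> computes f (i # xs) 0 \<and> s' = s(out := i)" for i
  proof -
    have "(?st i)(m + 1 := 0) = ?st i" using prem by (auto simp: fun_eq_iff)
    moreover have "(?st i)(m := 0, out := s out + i) = s(out := i)"
      using prem by (auto simp: fun_eq_iff)
    ultimately show ?thesis using c prem by (auto simp: relcomp_unfold sem_move)
  qed
  have "(s, s') \<in> sem (comp (Mu f) ins out m) \<longleftrightarrow> (\<exists>u. (s, u) \<in> body\<^sup>* \<and>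
     (u, s') \<in> sem (Seq (comp f (m # ins) (m + 1) (m + 2))
      (Seq (Atom (IfZero (m + 1))) (move m out))))"
    unfolding body_def comp.simps by (subst sem.simps) (auto simp del: comp.simps)
  also have "\<dots> \<longleftrightarrow> (\<exists>i. (\<forall>k<i. \<exists>y. computes f (k # xs) (Suc y)) \<and>
     (?st i, s') \<in> sem (Seq (comp f (m # ins) (m + 1) (m + 2))
      (Seq (Atom (IfZero (m + 1))) (move m out))))"
    unfolding loop by blast
  also have "\<dots> \<longleftrightarrow> (\<exists>i. computes (Mu f) xs i \<and> s' = s(out := i))"
    unfolding fin computes_Mu_iff by blast
  finally show ?thesis by (simp add: xs_def)
qed

text \<open>The arguments lie below \<open>j\<close> and the results are written from
  \<open>j\<close> on, so a result never disturbs the arguments of later functions.\<close>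

lemma comps_correct:
  assumes "\<And>g. g \<in> set gs \<Longrightarrow> comp_ok g"
    and "set ins \<subseteq> {..<j}" "m = j + length gs" "\<forall>r\<ge>j. s r = 0"
  shows "(s, s') \<in> sem (comps gs ins j m) \<longleftrightarrow>
    (\<exists>ys. list_all2 (\<lambda>g y. computes g (map s ins) y) gs ys \<and> s' = put s j ys)"
  using assms
proof (induction gs arbitrary: j s)
  case (Cons g gs)
  have "(s, u) \<in> sem (comp g ins j m) \<longleftrightarrow> (\<exists>y. computes g (map s ins) y \<and> u = s(j := y))" for u
    by (rule comp_okD) (use Cons.prems in auto)
  moreover have "(s(j := y), s') \<in> sem (comps gs ins (Suc j) m) \<longleftrightarrow>
      (\<exists>ys. list_all2 (\<lambda>g y. computes g (map s ins) y) gs ys \<and> s' = put (s(j := y)) (Suc j) ys)" for y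
  proof -
    have "map (s(j := y)) ins = map s ins" using Cons.prems(2) by auto
    moreover have "(s(j := y), s') \<in> sem (comps gs ins (Suc j) m) \<longleftrightarrow>
      (\<exists>ys. list_all2 (\<lambda>g z. computes g (map (s(j := y)) ins) z) gs ys \<and> s' = put (s(j := y)) (Suc j) ys)"
      by (rule Cons.IH) (use Cons.prems in \<open>auto simp: subset_iff less_Suc_eq\<close>)
    ultimately show ?thesis by (simp only:)
  qed
  ultimately show ?case by (fastforce simp: relcomp_unfold list_all2_Cons1)
qed auto

theorem comp_correct: "comp_ok f"
proof (induction f)
  case Zero
  show ?case by (auto simp: comp_ok_def computes_Zero_iff fun_eq_iff)
next
  case Succ
  show ?case unfolding comp_ok_def
  proof (intro allI impI)
    fix ins :: "nat list" and out m :: nat and s s' :: store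
    assume "set ins \<subseteq> {..<m}" "out < m" "out \<notin> set ins" "s out = 0" "\<forall>r\<ge>m. s r = 0"
    then show "(s, s') \<in> sem (comp Succ ins out m) \<longleftrightarrow>
        (\<exists>y. computes Succ (map s ins) y \<and> s' = s(out := y))"
      by (cases ins rule: remdups_adj.cases)
        (auto simp: computes_Succ_iff sem_fail relcomp_unfold sem_copy)
  qed
next
  case (Proj i)
  show ?case unfolding comp_ok_def
  proof (intro allI impI)
    fix ins :: "nat list" and out m :: nat and s s' :: store
    assume p: "set ins \<subseteq> {..<m}" "out < m" "out \<notin> set ins" "s out = 0" "\<forall>r\<ge>m. s r = 0"
    have "ins ! i < m \<and> ins ! i \<noteq> out" if "i < length ins"
      using nth_mem[OF that] p by auto
    then show "(s, s') \<in> sem (comp (Proj i) ins out m) \<longleftrightarrow>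
        (\<exists>y. computes (Proj i) (map s ins) y \<and> s' = s(out := y))"
      using p by (auto simp: computes_Proj_iff sem_fail sem_copy)
  qed
next
  case (Comp f gs)
  show ?case unfolding comp_ok_def
  proof (intro allI impI)
    fix ins :: "nat list" and out m :: nat and s s' :: store
    assume p: "set ins \<subseteq> {..<m}" "out < m" "out \<notin> set ins" "s out = 0" "\<forall>r\<ge>m. s r = 0"
    let ?l = "length gs"
    have gs: "(s, u) \<in> sem (comps gs ins m (m + ?l)) \<longleftrightarrow>
        (\<exists>ys. list_all2 (\<lambda>g y. computes g (map s ins) y) gs ys \<and> u = put s m ys)" for u
      by (rule comps_correct) (use Comp p in auto)
    have f: "(put s m ys, u) \<in> sem (comp f [m..<m + ?l] out (m + ?l)) \<longleftrightarrow>
        (\<exists>y. computes f ys y \<and> u = (put s m ys)(out := y))" if "length ys = ?l" for ys u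
    proof -
      have "(put s m ys, u) \<in> sem (comp f [m..<m + ?l] out (m + ?l)) \<longleftrightarrow>
        (\<exists>y. computes f (map (put s m ys) [m..<m + ?l]) y \<and> u = (put s m ys)(out := y))"
        by (rule comp_okD) (use Comp p that in \<open>auto simp: put_less put_geq\<close>)
      then show ?thesis using map_put[of s m ys] that by simp
    qed
    have e: "(\<lambda>r. if r \<in> set [m..<m + ?l] then 0 else ((put s m ys)(out := y)) r) = s(out := y)"
      if "length ys = ?l" for ys y
    proof
      fix r
      show "(if r \<in> set [m..<m + ?l] then 0 else ((put s m ys)(out := y)) r) = (s(out := y)) r"
        using p that by (cases "r < m") (auto simp: put_less put_geq)
    qed
    have len: "length ys = ?l" if "list_all2 (\<lambda>g y. computes g (map s ins) y) gs ys" for ys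
      using list_all2_lengthD[OF that] by simp
    have "(s, s') \<in> sem (comp (Comp f gs) ins out m) \<longleftrightarrow>
       (\<exists>ys. list_all2 (\<lambda>g y. computes g (map s ins) y) gs ys \<and>
         (\<exists>v. (put s m ys, v) \<in> sem (comp f [m..<m + ?l] out (m + ?l)) \<and>
           s' = (\<lambda>r. if r \<in> set [m..<m + ?l] then 0 else v r)))"
      unfolding comp.simps by (subst sem.simps)+ (simp only: relcomp_unfold gs sem_clears mem_Collect_eq split, blast)
    also have "\<dots> \<longleftrightarrow> (\<exists>ys. list_all2 (\<lambda>g y. computes g (map s ins) y) gs ys \<and>
         (\<exists>y. computes f ys y \<and> s' = s(out := y)))"
    proof (intro iff_exI conj_cong refl)
      fix ys assume l: "list_all2 (\<lambda>g y. computes g (map s ins) y) gs ys"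
      show "(\<exists>v. (put s m ys, v) \<in> sem (comp f [m..<m + ?l] out (m + ?l)) \<and>
           s' = (\<lambda>r. if r \<in> set [m..<m + ?l] then 0 else v r)) \<longleftrightarrow>
         (\<exists>y. computes f ys y \<and> s' = s(out := y))"
        unfolding f[OF len[OF l]] e[OF len[OF l], symmetric] by blast
    qed
    also have "\<dots> \<longleftrightarrow> (\<exists>y. computes (Comp f gs) (map s ins) y \<and> s' = s(out := y))"
      unfolding computes_Comp_iff by blast
    finally show "(s, s') \<in> sem (comp (Comp f gs) ins out m) \<longleftrightarrow>
        (\<exists>y. computes (Comp f gs) (map s ins) y \<and> s' = s(out := y))" .
  qed
next
  case (PrimRec f g)
  show ?case unfolding comp_ok_def
  proof (intro allI impI)
    fix ins :: "nat list" and out m :: nat and s s' :: store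
    assume p: "set ins \<subseteq> {..<m}" "out < m" "out \<notin> set ins" "s out = 0" "\<forall>r\<ge>m. s r = 0"
    show "(s, s') \<in> sem (comp (PrimRec f g) ins out m) \<longleftrightarrow>
        (\<exists>y. computes (PrimRec f g) (map s ins) y \<and> s' = s(out := y))"
    proof (cases ins)
      case Nil
      then show ?thesis by (auto simp: sem_fail elim: computes_PrimRec_NilE)
    next
      case (Cons n ins')
      show ?thesis unfolding Cons
        by (rule comp_PrimRec_correct) (use PrimRec p Cons in auto)
    qed
  qed
next
  case (Mu f)
  show ?case unfolding comp_ok_def using comp_Mu_correct[OF Mu] by blast
qed

section \<open>Recursive functions\<close>

text \<open>Total functions of fixed arity; the closure properties below are those from which
  \<open>instance_code\<close> is built.\<close>

definition recursive :: "nat \<Rightarrow> (nat list \<Rightarrow> nat) \<Rightarrow> bool" where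
  "recursive k F \<longleftrightarrow> (\<exists>f. \<forall>xs. length xs = k \<longrightarrow> computes f xs (F xs))"

lemma recursive_nth: "i < k \<Longrightarrow> recursive k (\<lambda>xs. xs ! i)"
  unfolding recursive_def by (metis computes.intros(3))

lemma recursive_comp:
  assumes G: "recursive (length Fs) G" and Fs: "\<forall>F \<in> set Fs. recursive k F"
  shows "recursive k (\<lambda>xs. G (map (\<lambda>F. F xs) Fs))"
proof -
  obtain g where g: "\<And>ys. length ys = length Fs \<Longrightarrow> computes g ys (G ys)"
    using G unfolding recursive_def by blast
  obtain f where f: "\<And>F xs. F \<in> set Fs \<Longrightarrow> length xs = k \<Longrightarrow> computes (f F) xs (F xs)"
    using Fs unfolding recursive_def by metis
  have "computes (Comp g (map f Fs)) xs (G (map (\<lambda>F. F xs) Fs))" if "length xs = k" for xs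
    by (rule computes.intros(4)[OF _ g])
      (auto simp: list_all2_conv_all_nth intro: f that)
  then show ?thesis unfolding recursive_def by blast
qed

lemma recursive_comp1:
  assumes "recursive (Suc 0) (\<lambda>xs. G (xs ! 0))" "recursive k A"
  shows "recursive k (\<lambda>xs. G (A xs))"
  using recursive_comp[of "[A]" "\<lambda>xs. G (xs ! 0)" k] assms by simp

lemma recursive_comp2:
  assumes "recursive 2 (\<lambda>xs. G (xs ! 0) (xs ! 1))" "recursive k A" "recursive k B"
  shows "recursive k (\<lambda>xs. G (A xs) (B xs))"
  using recursive_comp[of "[A, B]" "\<lambda>xs. G (xs ! 0) (xs ! 1)" k] assms
  by (simp add: numeral_2_eq_2)

lemma recursive_Suc: "recursive k A \<Longrightarrow> recursive k (\<lambda>xs. Suc (A xs))"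
  by (rule recursive_comp1) (auto simp: recursive_def length_Suc_conv intro!: exI computes.intros(2))

lemma recursive_const: "recursive k (\<lambda>_. c)"
proof (induction c)
  case 0
  show ?case unfolding recursive_def by (blast intro: computes.intros(1))
qed (rule recursive_Suc)

lemma recursive_rec:
  assumes B: "recursive k B" and S: "recursive (Suc (Suc k)) S"
    and 0: "\<And>xs. length xs = k \<Longrightarrow> F (0 # xs) = B xs"
    and Suc: "\<And>n xs. length xs = k \<Longrightarrow> F (Suc n # xs) = S (n # F (n # xs) # xs)"
  shows "recursive (Suc k) F"
proof -
  obtain f g where f: "\<And>xs. length xs = k \<Longrightarrow> computes f xs (B xs)"
    and g: "\<And>xs. length xs = Suc (Suc k) \<Longrightarrow> computes g xs (S xs)"
    using B S unfolding recursive_def by blast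
  have "computes (PrimRec f g) (n # xs) (F (n # xs))" if "length xs = k" for n xs
  proof (induction n)
    case (Suc n)
    show ?case unfolding assms(4)[OF that]
      by (rule computes.intros(6)[OF Suc g]) (simp add: that)
  qed (simp add: 0 that f computes.intros(5))
  then show ?thesis unfolding recursive_def by (metis length_Suc_conv)
qed

lemma recursive_add:
  assumes "recursive k A" "recursive k B" shows "recursive k (\<lambda>xs. A xs + B xs)"
proof (rule recursive_comp2[OF _ assms])
  have "recursive (Suc (Suc 0)) (\<lambda>xs. xs ! 0 + xs ! 1)"
    by (rule recursive_rec[where B = "\<lambda>xs. xs ! 0" and S = "\<lambda>xs. Suc (xs ! 1)"])
      (auto intro: recursive_nth recursive_Suc)
  then show "recursive 2 (\<lambda>xs. xs ! 0 + xs ! 1)" by (simp add: numeral_2_eq_2)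
qed

lemma recursive_power2:
  assumes "recursive k A" shows "recursive k (\<lambda>xs. 2 ^ A xs)"
proof (rule recursive_comp1[OF _ assms])
  show "recursive (Suc 0) (\<lambda>xs. 2 ^ (xs ! 0))"
    by (rule recursive_rec[where B = "\<lambda>_. 1" and S = "\<lambda>xs. xs ! 1 + xs ! 1"])
      (auto intro: recursive_nth recursive_const recursive_add)
qed

lemma recursive_triangle:
  assumes "recursive k A" shows "recursive k (\<lambda>xs. triangle (A xs))"
proof (rule recursive_comp1[OF _ assms])
  show "recursive (Suc 0) (\<lambda>xs. triangle (xs ! 0))"
    by (rule recursive_rec[where B = "\<lambda>_. 0" and S = "\<lambda>xs. xs ! 1 + Suc (xs ! 0)"])
      (auto intro!: recursive_nth recursive_const recursive_add recursive_Suc)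
qed

lemma recursive_prod_encode:
  assumes "recursive k A" "recursive k B" shows "recursive k (\<lambda>xs. prod_encode (A xs, B xs))"
  by (simp add: prod_encode_def) (intro recursive_add recursive_triangle assms)

lemma recursive_list_encode_Nil: "recursive k (\<lambda>xs. list_encode [])"
  by (rule recursive_const)

lemma recursive_list_encode_Cons:
  assumes "recursive k A" "recursive k (\<lambda>xs. list_encode (B xs))"
  shows "recursive k (\<lambda>xs. list_encode (A xs # B xs))"
  by simp (intro recursive_Suc recursive_prod_encode assms)

text \<open>The argument \<open>B xs\<close> is passed on to the summands because those of
  \<open>loader_code\<close> depend on \<open>d\<close> as well as on the index.\<close>

lemma recursive_sum:
  assumes "recursive 2 (\<lambda>xs. G (xs ! 0) (xs ! 1))" "recursive k A" "recursive k B"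
  shows "recursive k (\<lambda>xs. \<Sum>i<A xs. G i (B xs))"
proof (rule recursive_comp2[OF _ assms(2,3)])
  have "recursive (Suc (Suc 0)) (\<lambda>xs. \<Sum>i<xs ! 0. G i (xs ! 1))"
    by (rule recursive_rec[where B = "\<lambda>_. 0" and S = "\<lambda>xs. xs ! 1 + G (xs ! 0) (xs ! 2)"])
      (auto intro!: recursive_nth recursive_const recursive_add recursive_comp2[OF assms(1)])
  then show "recursive 2 (\<lambda>xs. \<Sum>i<xs ! 0. G i (xs ! 1))" by (simp add: numeral_2_eq_2)
qed

lemmas recursive_intros = recursive_const recursive_nth recursive_Suc recursive_add
  recursive_power2 recursive_prod_encode recursive_list_encode_Nil recursive_list_encode_Cons

section \<open>Reachability and maximal executions\<close>

lemma rtranclp_imp_path: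
  "r\<^sup>*\<^sup>* a b \<Longrightarrow> \<exists>f n. f 0 = a \<and> f n = b \<and> (\<forall>k<n. r (f k) (f (Suc k)))"
proof (induction rule: rtranclp_induct)
  case base
  show ?case by (intro exI[of _ "\<lambda>_. a"] exI[of _ 0]) auto
next
  case (step b c)
  then obtain f n where "f 0 = a" "f n = b" "\<forall>k<n. r (f k) (f (Suc k))" by blast
  with step show ?case
    by (intro exI[of _ "f(Suc n := c)"] exI[of _ "Suc n"]) (auto simp: less_Suc_eq)
qed

lemma path_imp_rtranclp:
  "(\<forall>k<n. r (f k) (f (Suc k))) \<Longrightarrow> k \<le> n \<Longrightarrow> r\<^sup>*\<^sup>* (f 0) (f k)"
proof (induction k)
  case (Suc k)
  then have "r\<^sup>*\<^sup>* (f 0) (f k)" "r (f k) (f (Suc k))" by auto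
  then show ?case by (rule rtranclp.rtrancl_into_rtrancl)
qed simp

text \<open>Maximality is no restriction: every finite run can be continued either for ever or up to
  a deadlock.\<close>

lemma reaches_iff_reachable:
  "(\<exists>\<rho> \<in> executions A N \<pi>. reaches \<rho> qf) \<longleftrightarrow>
   (\<exists>c. (step A \<pi>)\<^sup>*\<^sup>* (initial_config A N) c \<and> qf \<in> fst ` set c)"
proof safe
  fix \<rho> assume "\<rho> \<in> executions A N \<pi>" "reaches \<rho> qf"
  then obtain c where m: "maximal_execution A N \<pi> \<rho>" and c: "c \<in> visited \<rho>" "qf \<in> fst ` set c"
    by (auto simp: executions_def reaches_def)
  have "(step A \<pi>)\<^sup>*\<^sup>* (initial_config A N) c"
  proof (cases \<rho>)
    case (Finite cs)
    then obtain k where k: "k < length cs" "c = cs ! k" using c by (auto simp: in_set_conv_nth)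
    have "(step A \<pi>)\<^sup>*\<^sup>* (cs ! 0) (cs ! k)"
      by (rule path_imp_rtranclp[where n = "length cs - 1"]) (use Finite m k in auto)
    then show ?thesis using Finite m k by (simp add: hd_conv_nth[symmetric])
  next
    case (Infinite f)
    then obtain k where "c = f k" using c by auto
    then show ?thesis using path_imp_rtranclp[of k "step A \<pi>" f k] Infinite m by auto
  qed
  then show "\<exists>c. (step A \<pi>)\<^sup>*\<^sup>* (initial_config A N) c \<and> qf \<in> fst ` set c" using c by blast
next
  fix c s
  assume "(step A \<pi>)\<^sup>*\<^sup>* (initial_config A N) c" and s: "s \<in> set c"
  then obtain f n where f: "f 0 = initial_config A N" "f n = c"
      "\<And>k. k < n \<Longrightarrow> step A \<pi> (f k) (f (Suc k))"
    using rtranclp_imp_path by metis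
  define nxt where "nxt c = (SOME c'. step A \<pi> c c')" for c
  \<comment> \<open>The given run up to \<open>n\<close>, then arbitrary successors; values beyond a
    deadlock are meaningless and are cut off below.\<close>
  define h where "h k = (if k \<le> n then f k else (nxt ^^ (k - n)) c)" for k
  have hn: "h (Suc k) = nxt (h k)" if "n \<le> k" for k
    using that f by (auto simp: h_def Suc_diff_le)
  have hs: "step A \<pi> (h k) (h (Suc k))" if "k < n \<or> (\<exists>c'. step A \<pi> (h k) c')" for k
  proof (cases "k < n")
    case True
    then show ?thesis using f by (simp add: h_def)
  next
    case False
    then show ?thesis using hn[of k] that someI_ex[of "step A \<pi> (h k)"] by (simp add: nxt_def)
  qed
  have h: "h 0 = initial_config A N" "h n = c" using f by (auto simp: h_def)
  show "\<exists>\<rho>\<in>executions A N \<pi>. reaches \<rho> (fst s)"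
  proof (cases "\<exists>k\<ge>n. \<not> (\<exists>c'. step A \<pi> (h k) c')")
    case False
    then have "maximal_execution A N \<pi> (Infinite h)" using h hs by (auto simp: not_le[symmetric])
    moreover have "reaches (Infinite h) (fst s)" using h s by (auto simp: reaches_def)
    ultimately show ?thesis unfolding executions_def by blast
  next
    case True
    \<comment> \<open>The first deadlock from \<open>n\<close> on, so that the target is still
      visited before the cut.\<close>
    define m where "m = (LEAST k. k \<ge> n \<and> \<not> (\<exists>c'. step A \<pi> (h k) c'))"
    have m: "m \<ge> n" "\<not> (\<exists>c'. step A \<pi> (h m) c')"
      using LeastI_ex[of "\<lambda>k. k \<ge> n \<and> \<not> (\<exists>c'. step A \<pi> (h k) c')"] True by (auto simp: m_def)
    have l: "\<exists>c'. step A \<pi> (h k) c'" if "n \<le> k" "k < m" for k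
      using not_less_Least[of k "\<lambda>k. k \<ge> n \<and> \<not> (\<exists>c'. step A \<pi> (h k) c')"] that by (auto simp: m_def)
    let ?cs = "map h [0..<Suc m]"
    have "maximal_execution A N \<pi> (Finite ?cs)"
      unfolding maximal_execution.simps
    proof (intro conjI allI impI)
      show "hd ?cs = initial_config A N" using h by (simp add: hd_map del: upt_Suc)
      show "\<not> (\<exists>c'. step A \<pi> (last ?cs) c')" using m by simp
      fix k assume "Suc k < length ?cs"
      then have "k < m" by simp
      moreover have "step A \<pi> (h k) (h (Suc k))" using hs l \<open>k < m\<close> by (meson not_le)
      ultimately show "step A \<pi> (?cs ! k) (?cs ! Suc k)" by (simp del: upt_Suc)
    qed simp
    moreover have "reaches (Finite ?cs) (fst s)" 
      using h(2)[symmetric] s m unfolding reaches_def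
      by (auto simp del: upt_Suc intro!: bexI[of _ s] bexI[of _ c])
    ultimately show ?thesis unfolding executions_def by blast
  qed
qed

section \<open>The protocol simulating a control graph\<close>

text \<open>The first component of the code of a state or message is its kind. The controller is in a state
  \<open>ctrl q\<close> or \<open>wait q\<close>; the workers in \<open>place 0\<close> are idle, those in \<open>place (Suc r)\<close> make up the value
  of register \<open>r\<close>. To move one worker from \<open>a\<close> to \<open>b\<close>, the controller makes all workers in \<open>a\<close>
  candidates; the first one to broadcast \<open>chosen\<close> moves, the others return.\<close>

abbreviation "ctrl q \<equiv> prod_encode (0, q)"
abbreviation "wait q \<equiv> prod_encode (1, q)"
abbreviation "place a \<equiv> prod_encode (2, a)"
abbreviation "cand a b \<equiv> prod_encode (3, prod_encode (a, b))"
abbreviation "idle \<equiv> prod_encode (4, 0)"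
abbreviation "lost \<equiv> prod_encode (5, 0)"
abbreviation "final \<equiv> prod_encode (6, 0)"

abbreviation "msg_start \<equiv> prod_encode (0, 0)"
abbreviation "msg_chosen \<equiv> prod_encode (1, 0)"
abbreviation "msg_restart \<equiv> prod_encode (2, 0)"
abbreviation "msg_time \<equiv> prod_encode (3, 0)"
abbreviation "msg_move a b \<equiv> prod_encode (4, prod_encode (a, b))"
abbreviation "msg_zero a \<equiv> prod_encode (5, a)"

type_synonym nat_edge = "(nat, nat, nat, nat) edge"

definition move_edges :: "nat \<Rightarrow> nat \<Rightarrow> nat \<Rightarrow> nat \<Rightarrow> nat_edge set" where
  "move_edges a b q q' =
     {(ctrl q, {}, Send (msg_move a b), {}, wait q'), (wait q', {}, Recv msg_chosen, {}, ctrl q')}"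

fun trans_edges :: "nat \<times> instr \<times> nat \<Rightarrow> nat_edge set" where
  "trans_edges (q, Skip, q') = {(ctrl q, {}, Eps, {}, ctrl q')}"
| "trans_edges (q, Inc r, q') = move_edges 0 (Suc r) q q'"
| "trans_edges (q, Dec r, q') = move_edges (Suc r) 0 q q'"
| "trans_edges (q, IfZero r, q') = {(ctrl q, {}, Send (msg_zero (Suc r)), {}, ctrl q')}"

text \<open>The guard of \<open>msg_start\<close> lets the election happen only at time 0, so all
  clocks count from the same moment; its receivers become workers, hence a single controller. The
  target is entered by reception: only workers can tell that time 1 has passed, only the controller
  whether its current cycle is within \<open>p\<close>.\<close>

definition main_edges :: "nat_edge set" where
  "main_edges =
     {(idle, {(0, Le, Const 0)}, Send msg_start, {}, ctrl 0),
      (idle, {}, Recv msg_start, {}, place 0),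
      (place 0, {(0, Ge, Const 1)}, Send msg_time, {}, lost),
      (ctrl 0, {(0, Le, Param 0)}, Recv msg_time, {}, final),
      (ctrl 1, {(0, Le, Param 0)}, Send msg_restart, {0}, ctrl 0)}"

text \<open>All pairs of places are served, so that the set depends on the register bound alone and
  covers the moves of the loader whatever the program is.\<close>

definition worker_edges :: "nat \<Rightarrow> nat_edge set" where
  "worker_edges R =
     (\<Union>a\<le>R. {(place a, {}, Recv msg_restart, {}, place 0), (place a, {}, Recv (msg_zero a), {}, lost)}) \<union>
     (\<Union>a\<le>R. \<Union>b\<le>R. {(place a, {}, Recv (msg_move a b), {}, cand a b),
       (cand a b, {}, Send msg_chosen, {}, place b), (cand a b, {}, Recv msg_chosen, {}, place a)})"

text \<open>States and messages form whole initial segments, so that their set codes are sums of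
  powers of two determined by \<open>K\<close>.\<close>

definition protocol :: "nat graph \<Rightarrow> nat \<Rightarrow> nat \<Rightarrow> nat_ptbp" where
  "protocol T R K = \<lparr>states = {..<K}, clocks = {0}, alphabet = {..<K}, params = {0}, init = idle,
     edges = main_edges \<union> worker_edges R \<union> (\<Union>t \<in> T. trans_edges t)\<rparr>"

definition move_trans :: "nat graph \<Rightarrow> nat \<Rightarrow> nat \<Rightarrow> nat \<Rightarrow> nat \<Rightarrow> bool" where
  "move_trans T a b q q' \<longleftrightarrow>
     (\<exists>r. a = 0 \<and> b = Suc r \<and> (q, Inc r, q') \<in> T) \<or> (\<exists>r. a = Suc r \<and> b = 0 \<and> (q, Dec r, q') \<in> T)"

text \<open>A worker state is given by the place of the worker, \<open>None\<close> for a lost one; while the controller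
  waits for a worker moving from \<open>a\<close> to \<open>b\<close>, those of place \<open>a\<close> are candidates.\<close>

datatype mode = Ctrl nat | Wait nat nat nat

fun mode_state :: "mode \<Rightarrow> nat" where
  "mode_state (Ctrl q) = ctrl q"
| "mode_state (Wait a b q) = wait q"

fun worker_state :: "mode \<Rightarrow> nat option \<Rightarrow> nat" where
  "worker_state \<mu> None = lost"
| "worker_state (Ctrl q) (Some a) = place a"
| "worker_state (Wait a b q) (Some c) = (if c = a then cand a b else place c)"

text \<open>One valuation \<open>Y\<close> serves for all workers, since no edge resets the clock of
  a worker.\<close>

definition conf :: "nat \<Rightarrow> nat \<Rightarrow> mode \<Rightarrow> (nat \<Rightarrow> real) \<Rightarrow> (nat \<Rightarrow> nat option) \<Rightarrow> (nat \<Rightarrow> real) \<Rightarrow> (nat, nat) config"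
  where "conf N i \<mu> X f Y =
    map (\<lambda>j. if j = i then (mode_state \<mu>, X) else (worker_state \<mu> (f j), Y)) [0..<N]"

lemma length_conf [simp]: "length (conf N i \<mu> X f Y) = N"
  by (simp add: conf_def)

lemma nth_conf: "j < N \<Longrightarrow> conf N i \<mu> X f Y ! j =
    (if j = i then (mode_state \<mu>, X) else (worker_state \<mu> (f j), Y))"
  by (simp add: conf_def)

lemma conf_eqI:
  assumes "length c = N" "i < N" "c ! i = (mode_state \<mu>, X)"
    and "\<And>j. j < N \<Longrightarrow> j \<noteq> i \<Longrightarrow> c ! j = (worker_state \<mu> (f j), Y)"
  shows "c = conf N i \<mu> X f Y"
  using assms by (intro nth_equalityI) (auto simp: nth_conf)

lemma delay_conf: "delay t (conf N i \<mu> X f Y) = conf N i \<mu> (\<lambda>x. X x + t) f (\<lambda>x. Y x + t)"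
  by (auto simp: delay_def conf_def)

lemma reset_empty [simp]: "reset {} v = v"
  by (auto simp: reset_def)

locale simulation =
  fixes T :: "nat graph" and R K :: nat
  assumes T_regs: "(q, \<alpha>, q') \<in> T \<Longrightarrow> r \<in> instr_regs \<alpha> \<Longrightarrow> r < R"
begin

abbreviation "A \<equiv> protocol T R K"

text \<open>A waiting controller has arrived by a transition of the graph; hence its edge for
  \<open>msg_chosen\<close> exists and both places are within \<open>R\<close>.\<close>

fun mode_ok :: "mode \<Rightarrow> bool" where
  "mode_ok (Ctrl q) \<longleftrightarrow> True"
| "mode_ok (Wait a b q') \<longleftrightarrow> (\<exists>q. move_trans T a b q q')"

lemma move_trans_le: "move_trans T a b q q' \<Longrightarrow> a \<le> R \<and> b \<le> R"
  using T_regs by (force simp: move_trans_def)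

section \<open>Enabled edges and reactions of single processes\<close>

lemma fires_iff: "fires A \<pi> a (q, v) s' \<longleftrightarrow> (\<exists>g U q'. (q, g, a, U, q') \<in> edges A \<and> satisfies \<pi> v g \<and>
    s' = (q', reset U v))"
  by (auto simp: fires.simps)

lemma edge_iff: "e \<in> edges A \<longleftrightarrow> e \<in> main_edges \<or> e \<in> worker_edges R \<or> (\<exists>t \<in> T. e \<in> trans_edges t)"
  by (auto simp: protocol_def)

lemma move_transI:
  "(q, Inc r, q') \<in> T \<Longrightarrow> move_trans T 0 (Suc r) q q'"
  "(q, Dec r, q') \<in> T \<Longrightarrow> move_trans T (Suc r) 0 q q'"
  by (auto simp: move_trans_def)

lemma move_transE:
  assumes "move_trans T a b q q'"
  obtains t where "t \<in> T" "trans_edges t = move_edges a b q q'"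
  using assms unfolding move_trans_def
proof (elim disjE exE conjE)
  fix r assume "a = 0" "b = Suc r" "(q, Inc r, q') \<in> T"
  then show thesis using that[of "(q, Inc r, q')"] by simp
next
  fix r assume "a = Suc r" "b = 0" "(q, Dec r, q') \<in> T"
  then show thesis using that[of "(q, Dec r, q')"] by simp
qed

text \<open>Increments and decrements are merged into \<open>move_trans\<close>. A waiting state
  records only the target point, which is all that the edge leaving it needs.\<close>

lemma trans_edge_iff: "(\<exists>t \<in> T. (q, g, a, U, q') \<in> trans_edges t) \<longleftrightarrow>
    g = {} \<and> U = {} \<and>
    ((\<exists>p p'. (p, Skip, p') \<in> T \<and> q = ctrl p \<and> a = Eps \<and> q' = ctrl p') \<or>
     (\<exists>p p' r. (p, IfZero r, p') \<in> T \<and> q = ctrl p \<and> a = Send (msg_zero (Suc r)) \<and> q' = ctrl p') \<or>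
     (\<exists>p p' b c. move_trans T b c p p' \<and>
       (q = ctrl p \<and> a = Send (msg_move b c) \<and> q' = wait p' \<or>
        q = wait p' \<and> a = Recv msg_chosen \<and> q' = ctrl p')))" (is "?l \<longleftrightarrow> ?r")
proof
  assume ?l
  then obtain p \<alpha> p' where "(p, \<alpha>, p') \<in> T" "(q, g, a, U, q') \<in> trans_edges (p, \<alpha>, p')" by auto
  then show ?r by (cases \<alpha>) (auto simp: move_edges_def dest: move_transI)
next
  assume ?r
  then show ?l
  proof (elim conjE disjE exE)
    fix p p' assume "(p, Skip, p') \<in> T" "g = {}" "U = {}" "q = ctrl p" "a = Eps" "q' = ctrl p'"
    then show ?l by (intro bexI[of _ "(p, Skip, p')"]) simp_all
  next
    fix p p' r assume "(p, IfZero r, p') \<in> T" "g = {}" "U = {}" "q = ctrl p"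
      "a = Send (msg_zero (Suc r))" "q' = ctrl p'"
    then show ?l by (intro bexI[of _ "(p, IfZero r, p')"]) simp_all
  next
    fix p p' b c assume "move_trans T b c p p'"
      and "g = {}" "U = {}" "q = ctrl p" "a = Send (msg_move b c)" "q' = wait p'"
    then show ?l by (elim move_transE) (auto simp: move_edges_def)
  next
    fix p p' b c assume "move_trans T b c p p'"
      and "g = {}" "U = {}" "q = wait p'" "a = Recv msg_chosen" "q' = ctrl p'"
    then show ?l by (elim move_transE) (auto simp: move_edges_def)
  qed
qed

lemma satisfies_simps [simp]:
  "satisfies \<pi> v {}"
  "satisfies \<pi> v {(0, Le, b)} \<longleftrightarrow> v 0 \<le> real_of_rat (bound_value \<pi> b)"
  "satisfies \<pi> v {(0, Ge, b)} \<longleftrightarrow> v 0 \<ge> real_of_rat (bound_value \<pi> b)"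
  by (auto simp: satisfies_def)

lemmas edge_simps = fires_iff edge_iff trans_edge_iff main_edges_def worker_edges_def

lemma fires_Ctrl:
  "fires A \<pi> Eps (ctrl q, v) s' \<longleftrightarrow> (\<exists>q'. (q, Skip, q') \<in> T \<and> s' = (ctrl q', v))"
  "fires A \<pi> (Send m) (ctrl q, v) s' \<longleftrightarrow>
     q = 1 \<and> v 0 \<le> real_of_rat (\<pi> 0) \<and> m = msg_restart \<and> s' = (ctrl 0, reset {0} v) \<or>
     (\<exists>r q'. (q, IfZero r, q') \<in> T \<and> m = msg_zero (Suc r) \<and> s' = (ctrl q', v)) \<or>
     (\<exists>a b q'. move_trans T a b q q' \<and> m = msg_move a b \<and> s' = (wait q', v))"
  by (auto simp: edge_simps)

lemma fires_wait: "\<not> fires A \<pi> Eps (wait q, v) s'" "\<not> fires A \<pi> (Send m) (wait q, v) s'"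
  by (auto simp: edge_simps)

text \<open>While the controller waits for a move from \<open>a\<close>, an idle worker can still
  announce the time, except for \<open>a = 0\<close>, when the idle workers are candidates.\<close>

lemma fires_worker:
  "\<not> fires A \<pi> Eps (worker_state \<mu> u, v) s'"
  "fires A \<pi> (Send m) (worker_state (Ctrl q) u, v) s' \<longleftrightarrow>
     u = Some 0 \<and> m = msg_time \<and> 1 \<le> v 0 \<and> s' = (lost, v)"
  "mode_ok (Wait a b q) \<Longrightarrow> fires A \<pi> (Send m) (worker_state (Wait a b q) u, v) s' \<longleftrightarrow>
     u = Some a \<and> m = msg_chosen \<and> s' = (place b, v) \<or>
     a \<noteq> 0 \<and> u = Some 0 \<and> m = msg_time \<and> 1 \<le> v 0 \<and> s' = (lost, v)"
proof -
  show "\<not> fires A \<pi> Eps (worker_state \<mu> u, v) s'"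
    by (cases \<mu>; cases u) (auto simp: edge_simps)
  show "fires A \<pi> (Send m) (worker_state (Ctrl q) u, v) s' \<longleftrightarrow>
     u = Some 0 \<and> m = msg_time \<and> 1 \<le> v 0 \<and> s' = (lost, v)"
    by (cases u) (auto simp: edge_simps)
  show "fires A \<pi> (Send m) (worker_state (Wait a b q) u, v) s' \<longleftrightarrow>
     u = Some a \<and> m = msg_chosen \<and> s' = (place b, v) \<or>
     a \<noteq> 0 \<and> u = Some 0 \<and> m = msg_time \<and> 1 \<le> v 0 \<and> s' = (lost, v)" if "mode_ok (Wait a b q)"
    using that move_trans_le by (cases u) (auto simp: edge_simps)
qed

text \<open>In this protocol a process has at most one reaction to each message, so the effect of a
  broadcast on the receivers can be computed.\<close>

lemma receives_unique:
  assumes "\<And>s''. fires A \<pi> (Recv m) s s'' \<longleftrightarrow> P \<and> s'' = t"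
  shows "receives A \<pi> m s s' \<longleftrightarrow> s' = (if P then t else s)"
  unfolding receives_def assms by auto

text \<open>The new state is again a \<open>worker_state\<close> for the new mode, with a place that
  changes only on \<open>msg_restart\<close> and \<open>msg_zero\<close>: becoming a candidate and
  returning are changes of the mode, not of the place. The control point \<open>q'\<close> is
  arbitrary because workers do not see it.\<close>

lemma receives_worker:
  "(\<And>a. u = Some a \<Longrightarrow> a \<le> R) \<Longrightarrow> receives A \<pi> msg_restart (worker_state (Ctrl q) u, v) s' \<longleftrightarrow>
     s' = (worker_state (Ctrl q') (map_option (\<lambda>_. 0) u), v)"
  "a \<le> R \<Longrightarrow> receives A \<pi> (msg_zero a) (worker_state (Ctrl q) u, v) s' \<longleftrightarrow>
     s' = (worker_state (Ctrl q') (if u = Some a then None else u), v)"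
  "a \<le> R \<Longrightarrow> b \<le> R \<Longrightarrow> receives A \<pi> (msg_move a b) (worker_state (Ctrl q) u, v) s' \<longleftrightarrow>
     s' = (worker_state (Wait a b q') u, v)"
  "a \<le> R \<Longrightarrow> b \<le> R \<Longrightarrow> receives A \<pi> msg_chosen (worker_state (Wait a b q) u, v) s' \<longleftrightarrow>
     s' = (worker_state (Ctrl q') u, v)"
  "receives A \<pi> msg_time (worker_state \<mu> u, v) s' \<longleftrightarrow> s' = (worker_state \<mu> u, v)"
proof -
  show "receives A \<pi> msg_restart (worker_state (Ctrl q) u, v) s' \<longleftrightarrow>
     s' = (worker_state (Ctrl q') (map_option (\<lambda>_. 0) u), v)" if "\<And>a. u = Some a \<Longrightarrow> a \<le> R"
    using that
    by (subst receives_unique[where P = "u \<noteq> None" and t = "(place 0, v)"])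
      (cases u; auto simp: edge_simps)+
  show "receives A \<pi> (msg_zero a) (worker_state (Ctrl q) u, v) s' \<longleftrightarrow>
     s' = (worker_state (Ctrl q') (if u = Some a then None else u), v)" if "a \<le> R"
    using that
    by (subst receives_unique[where P = "u = Some a" and t = "(lost, v)"])
      (cases u; auto simp: edge_simps)+
  show "receives A \<pi> (msg_move a b) (worker_state (Ctrl q) u, v) s' \<longleftrightarrow>
     s' = (worker_state (Wait a b q') u, v)" if "a \<le> R" "b \<le> R"
    using that
    by (subst receives_unique[where P = "u = Some a" and t = "(cand a b, v)"])
      (cases u; auto simp: edge_simps)+
  show "receives A \<pi> msg_chosen (worker_state (Wait a b q) u, v) s' \<longleftrightarrow>
     s' = (worker_state (Ctrl q') u, v)" if "a \<le> R" "b \<le> R"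
    using that
    by (subst receives_unique[where P = "u = Some a" and t = "(place a, v)"])
      (cases u; auto simp: edge_simps)+
  show "receives A \<pi> msg_time (worker_state \<mu> u, v) s' \<longleftrightarrow> s' = (worker_state \<mu> u, v)"
    by (subst receives_unique[where P = False and t = "(lost, v)"])
      (cases u; cases \<mu>; auto simp: edge_simps)+
qed

lemma receives_controller:
  "mode_ok (Wait a b q) \<Longrightarrow> receives A \<pi> msg_chosen (wait q, v) s' \<longleftrightarrow> s' = (ctrl q, v)"
  "receives A \<pi> msg_time (ctrl q, v) s' \<longleftrightarrow>
     s' = (if q = 0 \<and> v 0 \<le> real_of_rat (\<pi> 0) then (final, v) else (ctrl q, v))"
  "receives A \<pi> msg_time (wait q, v) s' \<longleftrightarrow> s' = (wait q, v)"
proof -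
  show "receives A \<pi> msg_chosen (wait q, v) s' \<longleftrightarrow> s' = (ctrl q, v)" if "mode_ok (Wait a b q)"
    using that by (subst receives_unique[where P = True and t = "(ctrl q, v)"])
      (auto simp: edge_simps)
  show "receives A \<pi> msg_time (ctrl q, v) s' \<longleftrightarrow>
     s' = (if q = 0 \<and> v 0 \<le> real_of_rat (\<pi> 0) then (final, v) else (ctrl q, v))"
    by (subst receives_unique[where P = "q = 0 \<and> v 0 \<le> real_of_rat (\<pi> 0)" and t = "(final, v)"])
      (auto simp: edge_simps)
  show "receives A \<pi> msg_time (wait q, v) s' \<longleftrightarrow> s' = (wait q, v)"
    by (subst receives_unique[where P = False and t = "(lost, v)"])
      (auto simp: edge_simps)
qed


section \<open>Graphs that do not halt: every cycle costs a worker\<close>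

definition halts :: bool where
  "halts \<longleftrightarrow> (\<exists>s. (gstep T)\<^sup>*\<^sup>* (0, \<lambda>_. 0) (1, s))"

definition count :: "nat \<Rightarrow> nat \<Rightarrow> (nat \<Rightarrow> nat option) \<Rightarrow> store" where
  "count N i f r = card {j. j < N \<and> j \<noteq> i \<and> f j = Some (Suc r)}"

definition num_lost :: "nat \<Rightarrow> nat \<Rightarrow> (nat \<Rightarrow> nat option) \<Rightarrow> nat" where
  "num_lost N i f = card {j. j < N \<and> j \<noteq> i \<and> f j = None}"

definition bounded :: "(nat \<Rightarrow> nat option) \<Rightarrow> bool" where
  "bounded f \<longleftrightarrow> (\<forall>j a. f j = Some a \<longrightarrow> a \<le> R)"

lemma boundedD: "bounded f \<Longrightarrow> f j = Some a \<Longrightarrow> a \<le> R"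
  by (auto simp: bounded_def)

text \<open>The discrete steps that avoid the target, read on places; \<open>y\<close> is the time
  shown by the workers. A zero test on a nonempty register loses its workers instead of blocking,
  and this is where the simulation is unfaithful.\<close>

inductive sim_step :: "nat \<Rightarrow> nat \<Rightarrow> real \<Rightarrow> real \<Rightarrow> mode \<times> (nat \<Rightarrow> real) \<times> (nat \<Rightarrow> nat option) \<Rightarrow>
    mode \<times> (nat \<Rightarrow> real) \<times> (nat \<Rightarrow> nat option) \<Rightarrow> bool" for N i p y where
  skip: "(q, Skip, q') \<in> T \<Longrightarrow> sim_step N i p y (Ctrl q, X, f) (Ctrl q', X, f)"
| zero: "(q, IfZero r, q') \<in> T \<Longrightarrow> sim_step N i p y (Ctrl q, X, f)
    (Ctrl q', X, \<lambda>j. if f j = Some (Suc r) then None else f j)"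
| move: "move_trans T a b q q' \<Longrightarrow> sim_step N i p y (Ctrl q, X, f) (Wait a b q', X, f)"
| chosen: "k < N \<Longrightarrow> k \<noteq> i \<Longrightarrow> f k = Some a \<Longrightarrow>
    sim_step N i p y (Wait a b q, X, f) (Ctrl q, X, f(k := Some b))"
| restart: "X 0 \<le> p \<Longrightarrow>
    sim_step N i p y (Ctrl 1, X, f) (Ctrl 0, reset {0} X, \<lambda>j. map_option (\<lambda>_. 0) (f j))"
| time: "k < N \<Longrightarrow> k \<noteq> i \<Longrightarrow> f k = Some 0 \<Longrightarrow> 1 \<le> y \<Longrightarrow> sim_step N i p y (\<mu>, X, f) (\<mu>, X, f(k := None))"

text \<open>The acting process is the controller or one worker, and all others react in a unique
  way. The first alternative is kept apart because it alone can leave the form \<open>conf\<close>,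
  by entering \<open>final\<close>.\<close>

lemma discrete_step_conf_cases:
  assumes i: "i < N" and \<mu>: "mode_ok \<mu>" and f: "bounded f"
    and step: "discrete_step A \<pi> (conf N i \<mu> X f Y) c'"
  shows "(\<mu> = Ctrl 0 \<and> X 0 \<le> real_of_rat (\<pi> 0) \<and> 1 \<le> Y 0) \<or>
    (\<exists>\<mu>' X' f'. c' = conf N i \<mu>' X' f' Y \<and> sim_step N i (real_of_rat (\<pi> 0)) (Y 0) (\<mu>, X, f) (\<mu>', X', f'))"
  using step
proof cases
  case (internal k)
  have "k = i"
    using internal(2,3) fires_worker(1) by (auto simp: nth_conf split: if_splits)
  then obtain q where q: "\<mu> = Ctrl q"
    using internal(3) i fires_wait(1) by (cases \<mu>) (auto simp: nth_conf)
  then obtain q' where q': "(q, Skip, q') \<in> T" "c' ! i = (ctrl q', X)"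
    using internal(3) i \<open>k = i\<close> by (auto simp: nth_conf fires_Ctrl)
  have "c' = conf N i (Ctrl q') X f Y"
  proof (rule conf_eqI)
    fix j assume "j < N" "j \<noteq> i"
    then show "c' ! j = (worker_state (Ctrl q') (f j), Y)"
      using internal(4)[of j] \<open>k = i\<close> q by (cases "f j") (auto simp: nth_conf)
  qed (use internal(1) i q' in auto)
  then show ?thesis using sim_step.skip[OF q'(1)] q by blast
next
  case (broadcast k m)
  have k: "k < N" and len: "length c' = N" using broadcast(1,2) by auto
  show ?thesis
  proof (cases "k = i")
    case True
    have others: "receives A \<pi> m (worker_state \<mu> (f j), Y) (c' ! j)" if "j < N" "j \<noteq> i" for j
      using broadcast(4)[of j] that True by (simp add: nth_conf)
    have sends: "fires A \<pi> (Send m) (mode_state \<mu>, X) (c' ! i)"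
      using broadcast(3) i True by (simp add: nth_conf)
    then obtain q where q: "\<mu> = Ctrl q"
      using fires_wait(2) by (cases \<mu>) auto
    from sends consider
        (restart) "q = 1" "X 0 \<le> real_of_rat (\<pi> 0)" "m = msg_restart" "c' ! i = (ctrl 0, reset {0} X)"
      | (zero) r q' where "(q, IfZero r, q') \<in> T" "m = msg_zero (Suc r)" "c' ! i = (ctrl q', X)"
      | (move) a b q' where "move_trans T a b q q'" "m = msg_move a b" "c' ! i = (wait q', X)"
      unfolding q mode_state.simps fires_Ctrl by blast
    then show ?thesis
    proof cases
      case restart
      have "c' = conf N i (Ctrl 0) (reset {0} X) (\<lambda>j. map_option (\<lambda>_. 0) (f j)) Y"
      proof (rule conf_eqI)
        fix j assume j: "j < N" "j \<noteq> i"
        show "c' ! j = (worker_state (Ctrl 0) (map_option (\<lambda>_. 0) (f j)), Y)"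
          using others[OF j] boundedD[OF f] unfolding q restart
          by (subst (asm) receives_worker(1)[where q' = 0]) auto
      qed (use len i restart in auto)
      then show ?thesis using sim_step.restart restart q by blast
    next
      case (zero r q')
      have "Suc r \<le> R" using T_regs[OF zero(1)] by simp
      have "c' = conf N i (Ctrl q') X (\<lambda>j. if f j = Some (Suc r) then None else f j) Y"
      proof (rule conf_eqI)
        fix j assume j: "j < N" "j \<noteq> i"
        show "c' ! j = (worker_state (Ctrl q') (if f j = Some (Suc r) then None else f j), Y)"
          using others[OF j] unfolding q zero
          by (subst (asm) receives_worker(2)[OF \<open>Suc r \<le> R\<close>, where q' = q']) auto
      qed (use len i zero in auto)
      then show ?thesis using sim_step.zero[OF zero(1)] q by blast
    next
      case (move a b q')
      have "a \<le> R" "b \<le> R" using move_trans_le move(1) by auto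
      have "c' = conf N i (Wait a b q') X f Y"
      proof (rule conf_eqI)
        fix j assume j: "j < N" "j \<noteq> i"
        show "c' ! j = (worker_state (Wait a b q') (f j), Y)"
          using others[OF j] unfolding q move
          by (subst (asm) receives_worker(3)[OF \<open>a \<le> R\<close> \<open>b \<le> R\<close>, where q' = q']) auto
      qed (use len i move in auto)
      then show ?thesis using sim_step.move[OF move(1)] q by blast
    qed
  next
    case False
    have others: "receives A \<pi> m (worker_state \<mu> (f j), Y) (c' ! j)" if "j < N" "j \<noteq> i" "j \<noteq> k" for j
      using broadcast(4)[of j] that by (simp add: nth_conf)
    have contr: "receives A \<pi> m (mode_state \<mu>, X) (c' ! i)"
      using broadcast(4)[of i] i False by (simp add: nth_conf)
    have sends: "fires A \<pi> (Send m) (worker_state \<mu> (f k), Y) (c' ! k)"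
      using broadcast(3) k False by (simp add: nth_conf)
    consider
        (time) "f k = Some 0" "m = msg_time" "1 \<le> Y 0" "c' ! k = (lost, Y)"
      | (chosen) a b q where "\<mu> = Wait a b q" "f k = Some a" "m = msg_chosen" "c' ! k = (place b, Y)"
    proof (cases \<mu>)
      case (Ctrl q)
      then show ?thesis using sends that(1) unfolding Ctrl fires_worker(2) by blast
    next
      case (Wait a b q)
      have "mode_ok (Wait a b q)" using \<mu> Wait by simp
      then show ?thesis using sends that Wait unfolding Wait by (subst (asm) fires_worker(3)) blast+
    qed
    then show ?thesis
    proof cases
      case time
      show ?thesis
      proof (cases "\<mu> = Ctrl 0 \<and> X 0 \<le> real_of_rat (\<pi> 0)")
        case True
        then show ?thesis using time by blast
      next
        case nf: False
        have "c' ! i = (mode_state \<mu>, X)"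
          using contr nf unfolding time by (cases \<mu>) (auto simp: receives_controller simp del: One_nat_def)
        moreover have "c' ! j = (worker_state \<mu> ((f(k := None)) j), Y)" if "j < N" "j \<noteq> i" for j
          using others[OF that] time(4) unfolding time(2) receives_worker(5) by (cases "j = k") auto
        ultimately have "c' = conf N i \<mu> X (f(k := None)) Y"
          using len i by (intro conf_eqI)
        then show ?thesis using sim_step.time[of k N i f "Y 0", OF k False time(1,3)] by blast
      qed
    next
      case (chosen a b q)
      have ok: "mode_ok (Wait a b q)" using \<mu> chosen by simp
      then have "a \<le> R" "b \<le> R" using move_trans_le by auto
      have "c' ! i = (ctrl q, X)"
        using contr unfolding chosen mode_state.simps receives_controller(1)[OF ok] .
      moreover have "c' ! j = (worker_state (Ctrl q) ((f(k := Some b)) j), Y)" if "j < N" "j \<noteq> i" for j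
        using others[OF that] chosen(4)
        unfolding chosen(1,3) receives_worker(4)[OF \<open>a \<le> R\<close> \<open>b \<le> R\<close>, where q' = q]
        by (cases "j = k") auto
      ultimately have "c' = conf N i (Ctrl q) X (f(k := Some b)) Y"
        using len i by (intro conf_eqI) auto
      then show ?thesis using sim_step.chosen[of k N i f a, OF k False chosen(2)] chosen(1) by blast
    qed
  qed
qed

lemma fires_idle:
  "\<not> fires A \<pi> Eps (idle, v) s'"
  "fires A \<pi> (Send m) (idle, v) s' \<longleftrightarrow> m = msg_start \<and> v 0 \<le> 0 \<and> s' = (ctrl 0, v)"
  by (auto simp: edge_simps)

lemma receives_idle: "receives A \<pi> msg_start (idle, v) s' \<longleftrightarrow> s' = (place 0, v)"
  by (subst receives_unique[where P = True and t = "(place 0, v)"]) (auto simp: edge_simps)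

lemma delay_initial: "delay t (initial_config A N) = replicate N (idle, \<lambda>_. t)"
  by (simp add: delay_def initial_config_def protocol_def)

text \<open>All clocks equal the delay, so the guard of \<open>msg_start\<close> forces it to be
  0.\<close>

lemma step_initial:
  assumes "step A \<pi> (initial_config A N) c'"
  shows "\<exists>i<N. c' = conf N i (Ctrl 0) (\<lambda>_. 0) (\<lambda>_. Some 0) (\<lambda>_. 0)"
proof -
  obtain t where t: "t \<ge> 0" "discrete_step A \<pi> (replicate N (idle, \<lambda>_. t)) c'"
    using assms by (auto simp: step_def delay_initial)
  from t(2) show ?thesis
  proof cases
    case (internal i)
    then show ?thesis by (simp add: fires_idle)
  next
    case (broadcast i m)
    then have "m = msg_start" "t = 0" "c' ! i = (ctrl 0, \<lambda>_. t)"
      using t(1) by (auto simp: fires_idle)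
    then have "c' = conf N i (Ctrl 0) (\<lambda>_. 0) (\<lambda>_. Some 0) (\<lambda>_. 0)"
      using broadcast by (intro conf_eqI) (auto simp: receives_idle)
    then show ?thesis using broadcast(2) by auto
  qed
qed

text \<open>Describes a cycle that has lost nothing. While the controller waits, the store is still
  the one before the move, because candidates count for their old place.\<close>

fun consistent :: "nat \<Rightarrow> nat \<Rightarrow> mode \<Rightarrow> (nat \<Rightarrow> nat option) \<Rightarrow> bool" where
  "consistent N i (Ctrl q) f \<longleftrightarrow> (gstep T)\<^sup>*\<^sup>* (0, \<lambda>_. 0) (q, count N i f)"
| "consistent N i (Wait a b q') f \<longleftrightarrow>
     (\<exists>q. (gstep T)\<^sup>*\<^sup>* (0, \<lambda>_. 0) (q, count N i f) \<and> move_trans T a b q q')"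

text \<open>\<open>L\<close> bounds the number of completed cycles: it is the number of workers lost before the current
  cycle, and a cycle without loss is a faithful run of the control graph.\<close>

definition invariant :: "nat \<Rightarrow> nat \<Rightarrow> real \<Rightarrow> real \<Rightarrow> mode \<times> (nat \<Rightarrow> real) \<times> (nat \<Rightarrow> nat option) \<Rightarrow> bool"
  where "invariant N i p y = (\<lambda>(\<mu>, X, f). mode_ok \<mu> \<and> bounded f \<and>
    (\<exists>L. y \<le> X 0 + p * real L \<and> L \<le> num_lost N i f \<and> (L < num_lost N i f \<or> consistent N i \<mu> f)))"

lemma invariantI:
  assumes "mode_ok \<mu>" "bounded f" "y \<le> X 0 + p * real L" "L \<le> num_lost N i f"
    "L < num_lost N i f \<or> consistent N i \<mu> f"
  shows "invariant N i p y (\<mu>, X, f)"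
  unfolding invariant_def prod.case using assms by blast

lemma num_lost_mono:
  assumes "\<And>j. j < N \<Longrightarrow> j \<noteq> i \<Longrightarrow> f j = None \<Longrightarrow> f' j = None"
  shows "num_lost N i f \<le> num_lost N i f'"
  unfolding num_lost_def by (rule card_mono) (use assms in auto)

lemma num_lost_strict_mono:
  assumes "\<And>j. j < N \<Longrightarrow> j \<noteq> i \<Longrightarrow> f j = None \<Longrightarrow> f' j = None"
    and "k < N" "k \<noteq> i" "f k \<noteq> None" "f' k = None"
  shows "num_lost N i f < num_lost N i f'"
  unfolding num_lost_def
proof (rule psubset_card_mono)
  have "{j. j < N \<and> j \<noteq> i \<and> f j = None} \<subseteq> {j. j < N \<and> j \<noteq> i \<and> f' j = None}"
    using assms(1) by auto
  moreover have "k \<notin> {j. j < N \<and> j \<noteq> i \<and> f j = None}" "k \<in> {j. j < N \<and> j \<noteq> i \<and> f' j = None}"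
    using assms(2-5) by auto
  ultimately show "{j. j < N \<and> j \<noteq> i \<and> f j = None} \<subset> {j. j < N \<and> j \<noteq> i \<and> f' j = None}"
    by blast
qed simp

lemma count_Inc:
  assumes k: "k < N" "k \<noteq> i" "f k = Some 0"
  shows "count N i (f(k := Some (Suc r))) = (count N i f)(r := Suc (count N i f r))"
proof
  fix r'
  show "count N i (f(k := Some (Suc r))) r' = ((count N i f)(r := Suc (count N i f r))) r'"
  proof (cases "r' = r")
    case True
    have "{j. j < N \<and> j \<noteq> i \<and> (f(k := Some (Suc r))) j = Some (Suc r)} =
        insert k {j. j < N \<and> j \<noteq> i \<and> f j = Some (Suc r)}"
      using k by auto
    then show ?thesis using True k by (simp add: count_def)
  next
    case False
    have "{j. j < N \<and> j \<noteq> i \<and> (f(k := Some (Suc r))) j = Some (Suc r')} =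
        {j. j < N \<and> j \<noteq> i \<and> f j = Some (Suc r')}"
      using k False by auto
    then show ?thesis using False by (simp add: count_def)
  qed
qed

lemma count_Dec:
  assumes k: "k < N" "k \<noteq> i" "f k = Some (Suc r)"
  shows "count N i (f(k := Some 0)) = (count N i f)(r := count N i f r - 1)"
proof
  fix r'
  show "count N i (f(k := Some 0)) r' = ((count N i f)(r := count N i f r - 1)) r'"
  proof (cases "r' = r")
    case True
    have "{j. j < N \<and> j \<noteq> i \<and> (f(k := Some 0)) j = Some (Suc r)} =
        {j. j < N \<and> j \<noteq> i \<and> f j = Some (Suc r)} - {k}"
      using k by auto
    then show ?thesis using True k by (simp add: count_def)
  next
    case False
    have "{j. j < N \<and> j \<noteq> i \<and> (f(k := Some 0)) j = Some (Suc r')} =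
        {j. j < N \<and> j \<noteq> i \<and> f j = Some (Suc r')}"
      using k False by auto
    then show ?thesis using False by (simp add: count_def)
  qed
qed

lemma count_move:
  assumes k: "k < N" "k \<noteq> i" "f k = Some a" and t: "move_trans T a b q q'"
  shows "gstep T (q, count N i f) (q', count N i (f(k := Some b)))"
  using t unfolding move_trans_def
proof (elim disjE exE conjE)
  fix r assume r: "a = 0" "b = Suc r" "(q, Inc r, q') \<in> T"
  then have "exec (Inc r) (count N i f) (count N i (f(k := Some b)))"
    using count_Inc[of k N i f r] k by simp
  with r(3) show ?thesis unfolding gstep_def fst_conv snd_conv by blast
next
  fix r assume r: "a = Suc r" "b = 0" "(q, Dec r, q') \<in> T"
  have "count N i f r > 0"
    unfolding count_def using k r by (auto simp: card_gt_0_iff)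
  then have "exec (Dec r) (count N i f) (count N i (f(k := Some b)))"
    using count_Dec[of k N i f r] k r by simp
  with r(3) show ?thesis unfolding gstep_def fst_conv snd_conv by blast
qed

lemma count_zero_cong:
  assumes "count N i f r = 0" "j < N" "j \<noteq> i"
  shows "f j \<noteq> Some (Suc r)"
  using assms by (auto simp: count_def card_eq_0_iff)

text \<open>Each step of a cycle is faithful or raises the number of losses: a zero test on a
  nonempty register and an announcement of the time both lose a worker. At a restart the cycle
  cannot have been faithful, since the graph does not halt, so it has lost a worker that pays for
  its duration of at most \<open>p\<close>.\<close>

lemma invariant_sim_step:
  assumes nh: "\<not> halts" and p: "p \<ge> 0" and inv: "invariant N i p y s" and st: "sim_step N i p y s s'"
  shows "invariant N i p y s'"
  using st inv
proof cases
  case (skip q q' X f)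
  have "gstep T (q, count N i f) (q', count N i f)"
    using skip(3) by (auto simp: gstep_def intro!: exI[of _ Skip])
  then have "consistent N i (Ctrl q) f \<Longrightarrow> consistent N i (Ctrl q') f"
    unfolding consistent.simps by (rule rtranclp.rtrancl_into_rtrancl[rotated])
  then show ?thesis using inv skip by (auto simp: invariant_def)
next
  case (zero q r q' X f)
  let ?f = "\<lambda>j. if f j = Some (Suc r) then None else f j"
  obtain L where L: "y \<le> X 0 + p * real L" "L \<le> num_lost N i f"
      "L < num_lost N i f \<or> consistent N i (Ctrl q) f"
    using inv zero by (auto simp: invariant_def)
  have b: "bounded ?f" using inv zero by (auto simp: invariant_def bounded_def)
  have le: "num_lost N i f \<le> num_lost N i ?f" by (rule num_lost_mono) auto
  have "L < num_lost N i ?f \<or> consistent N i (Ctrl q') ?f"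
  proof (cases "count N i f r = 0")
    case True
    have "count N i ?f = count N i f"
      unfolding count_def using count_zero_cong[OF True]
      by (intro ext arg_cong[of _ _ card]) auto
    moreover have "gstep T (q, count N i f) (q', count N i f)"
      using zero(3) True by (auto simp: gstep_def intro!: exI[of _ "IfZero r"])
    ultimately have "consistent N i (Ctrl q) f \<Longrightarrow> consistent N i (Ctrl q') ?f"
      unfolding consistent.simps by (metis rtranclp.rtrancl_into_rtrancl)
    then show ?thesis using L le by linarith
  next
    case False
    then obtain k where "k < N" "k \<noteq> i" "f k = Some (Suc r)"
      by (auto simp: count_def card_eq_0_iff)
    then have "num_lost N i f < num_lost N i ?f" by (intro num_lost_strict_mono) auto
    then show ?thesis using L by simp
  qed
  with L le b show ?thesis unfolding zero by (intro invariantI[where L = L]) auto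
next
  case (move a b q q' X f)
  then show ?thesis using inv by (auto simp: invariant_def)
next
  case (chosen k f a b q' X)
  let ?f = "f(k := Some b)"
  obtain L where L: "y \<le> X 0 + p * real L" "L \<le> num_lost N i f"
      "L < num_lost N i f \<or> consistent N i (Wait a b q') f"
    using inv chosen by (auto simp: invariant_def)
  have "b \<le> R" using inv chosen move_trans_le by (auto simp: invariant_def)
  then have b: "bounded ?f" using inv chosen by (auto simp: invariant_def bounded_def)
  have le: "num_lost N i f \<le> num_lost N i ?f" by (rule num_lost_mono) (use chosen in auto)
  have "consistent N i (Wait a b q') f \<Longrightarrow> consistent N i (Ctrl q') ?f"
    unfolding consistent.simps using count_move[of k N i f a b] chosen(3-)
    by (metis rtranclp.rtrancl_into_rtrancl)
  then have "L < num_lost N i ?f \<or> consistent N i (Ctrl q') ?f" using L le by linarith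
  with L le b show ?thesis unfolding chosen by (intro invariantI[where L = L]) auto
next
  case (restart X f)
  let ?f = "\<lambda>j. map_option (\<lambda>_. 0) (f j) :: nat option"
  obtain L where L: "y \<le> X 0 + p * real L" "L \<le> num_lost N i f"
      "L < num_lost N i f \<or> consistent N i (Ctrl 1) f"
    using inv restart by (auto simp: invariant_def)
  have "\<not> consistent N i (Ctrl 1) f" using nh by (auto simp: halts_def)
  then have "Suc L \<le> num_lost N i f" using L(3) by linarith
  \<comment> \<open>The cycle just ended adds at most \<open>p\<close>, and there are
    \<open>Suc L\<close> losses to pay for it. The new \<open>L\<close> is the full number of
    losses, because the next cycle starts faithful.\<close>
  then have "p * real (Suc L) \<le> p * real (num_lost N i f)"
    using p by (intro mult_left_mono of_nat_mono)
  moreover have "num_lost N i ?f = num_lost N i f" by (simp add: num_lost_def)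
  moreover have "consistent N i (Ctrl 0) ?f"
  proof -
    have "count N i ?f = (\<lambda>_. 0)" by (auto simp: count_def fun_eq_iff card_eq_0_iff)
    then show ?thesis by simp
  qed
  moreover have "bounded ?f" by (auto simp: bounded_def)
  ultimately show ?thesis using L restart(3) unfolding restart(2)
    by (intro invariantI[where L = "num_lost N i f"]) (auto simp: reset_def algebra_simps)
next
  case (time k f \<mu> X)
  have "num_lost N i f < num_lost N i (f(k := None))"
    by (rule num_lost_strict_mono[of _ _ _ _ k]) (use time in auto)
  moreover have "bounded (f(k := None))" using inv time by (auto simp: invariant_def bounded_def)
  moreover obtain L where "mode_ok \<mu>" "y \<le> X 0 + p * real L" "L \<le> num_lost N i f"
    using inv time by (auto simp: invariant_def)
  ultimately show ?thesis unfolding time(2) by (intro invariantI[where L = L]) auto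
qed

text \<open>The controller itself is never lost, so at most \<open>N - 1\<close> cycles are
  complete. If the current one is still within \<open>p\<close>, the elapsed time is at most
  \<open>N / (N + 1)\<close>, less than the 1 required for entering the target.\<close>

lemma reachable_invariant:
  assumes nh: "\<not> halts" and p: "\<pi> 0 = 1 / (of_nat N + 1)"
    and "(step A \<pi>)\<^sup>*\<^sup>* (initial_config A N) c"
  shows "c = initial_config A N \<or>
    (\<exists>i<N. \<exists>\<mu> X f Y. c = conf N i \<mu> X f Y \<and> invariant N i (real_of_rat (\<pi> 0)) (Y 0) (\<mu>, X, f))"
  using assms(3)
proof (induction rule: rtranclp_induct)
  case base
  show ?case by simp
next
  case (step c c')
  have rp: "real_of_rat (\<pi> 0) = 1 / (real N + 1)"
    unfolding p by (simp add: of_rat_divide of_rat_add)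
  from step.IH show ?case
  proof
    assume "c = initial_config A N"
    with step(2) step_initial[of \<pi> N c'] obtain i where i: "i < N"
      "c' = conf N i (Ctrl 0) (\<lambda>_. 0) (\<lambda>_. Some 0) (\<lambda>_. 0)" by auto
    have "count N i (\<lambda>_. Some 0) = (\<lambda>_. 0)" by (auto simp: count_def)
    then have "invariant N i (real_of_rat (\<pi> 0)) 0 (Ctrl 0, \<lambda>_. 0, \<lambda>_. Some 0)"
      by (auto simp: invariant_def bounded_def intro!: exI[of _ 0])
    with i show ?thesis by blast
  next
    assume "\<exists>i<N. \<exists>\<mu> X f Y. c = conf N i \<mu> X f Y \<and> invariant N i (real_of_rat (\<pi> 0)) (Y 0) (\<mu>, X, f)"
    then obtain i \<mu> X f Y where i: "i < N" and c: "c = conf N i \<mu> X f Y"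
      and inv: "invariant N i (real_of_rat (\<pi> 0)) (Y 0) (\<mu>, X, f)" by blast
    from step(2) c obtain t where
      "discrete_step A \<pi> (conf N i \<mu> (\<lambda>x. X x + t) f (\<lambda>x. Y x + t)) c'"
      by (auto simp: step_def delay_conf)
    moreover have inv': "invariant N i (real_of_rat (\<pi> 0)) (Y 0 + t) (\<mu>, \<lambda>x. X x + t, f)"
      using inv by (auto simp: invariant_def algebra_simps)
    ultimately have cases: "(\<mu> = Ctrl 0 \<and> X 0 + t \<le> real_of_rat (\<pi> 0) \<and> 1 \<le> Y 0 + t) \<or>
      (\<exists>\<mu>' X' f'. c' = conf N i \<mu>' X' f' (\<lambda>x. Y x + t) \<and>
        sim_step N i (real_of_rat (\<pi> 0)) (Y 0 + t) (\<mu>, \<lambda>x. X x + t, f) (\<mu>', X', f'))"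
      using discrete_step_conf_cases[OF i, of \<mu> f \<pi> "\<lambda>x. X x + t" "\<lambda>x. Y x + t" c']
      by (auto simp: invariant_def)
    have "\<not> (X 0 + t \<le> real_of_rat (\<pi> 0) \<and> 1 \<le> Y 0 + t)"
    proof
      assume a: "X 0 + t \<le> real_of_rat (\<pi> 0) \<and> 1 \<le> Y 0 + t"
      obtain L where L: "Y 0 + t \<le> X 0 + t + real_of_rat (\<pi> 0) * real L" "L \<le> num_lost N i f"
        using inv' by (auto simp: invariant_def)
      have "num_lost N i f < N"
      proof -
        have "{j. j < N \<and> j \<noteq> i \<and> f j = None} \<subset> {..<N}" using i by auto
        from psubset_card_mono[OF _ this] show ?thesis by (simp add: num_lost_def)
      qed
      with L have "real L + 1 \<le> real N" by simp
      have "1 \<le> real_of_rat (\<pi> 0) * (real L + 1)" using L a by (simp add: algebra_simps)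
      also have "\<dots> \<le> real_of_rat (\<pi> 0) * real N"
        using \<open>real L + 1 \<le> real N\<close> by (intro mult_left_mono) (simp_all add: rp)
      also have "\<dots> < 1" by (simp add: rp field_simps)
      finally show False by simp
    qed
    with cases obtain \<mu>' X' f' where "c' = conf N i \<mu>' X' f' (\<lambda>x. Y x + t)"
      "sim_step N i (real_of_rat (\<pi> 0)) (Y 0 + t) (\<mu>, \<lambda>x. X x + t, f) (\<mu>', X', f')" by blast
    moreover have "real_of_rat (\<pi> 0) \<ge> 0" by (simp add: rp)
    ultimately show ?thesis using invariant_sim_step[OF nh _ inv'] i by blast
  qed
qed

text \<open>The network size is chosen before the parameter, so the valuation may depend on it;
  \<open>1 / (N + 1)\<close> lies in the interval for every \<open>N\<close>, with the closed end
  covering \<open>N = 0\<close>.\<close>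

lemma not_universal:
  assumes "\<not> halts"
  shows "\<not> exists_EF_universal (A, \<lambda>_. LeftOpenIv 0 1, final)"
proof
  assume "exists_EF_universal (A, \<lambda>_. LeftOpenIv 0 1, final)"
  then obtain N where N: "\<And>\<pi>. \<pi> \<in> valuations_in A (\<lambda>_. LeftOpenIv 0 1) \<Longrightarrow>
      \<exists>\<rho> \<in> executions A N \<pi>. reaches \<rho> final" by auto
  let ?\<pi> = "\<lambda>_ :: nat. 1 / (of_nat N + 1) :: rat"
  have "?\<pi> \<in> valuations_in A (\<lambda>_. LeftOpenIv 0 1)"
    by (auto simp: valuations_in_def add_nonneg_pos field_simps)
  from N[OF this] obtain c where "(step A ?\<pi>)\<^sup>*\<^sup>* (initial_config A N) c" "final \<in> fst ` set c"
    unfolding reaches_iff_reachable by blast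
  with reachable_invariant[OF assms, of ?\<pi> N c]
  have "final \<in> fst ` set (initial_config A N) \<or> (\<exists>i \<mu> X f Y. final \<in> fst ` set (conf N i \<mu> X f Y))"
    by blast
  moreover have final: "final \<noteq> mode_state \<mu>" "final \<noteq> worker_state \<mu> u" for \<mu> u
    by (cases \<mu>; cases u; simp)+
  ultimately show False
    by (auto simp: initial_config_def protocol_def conf_def final split: if_splits)
qed


section \<open>Graphs that halt: cycles without loss\<close>

lemma step_if_discrete: "discrete_step A \<pi> (conf N i \<mu> X f Y) c' \<Longrightarrow> step A \<pi> (conf N i \<mu> X f Y) c'"
  unfolding step_def by (rule exI[of _ 0]) (simp add: delay_conf)

lemma discrete_internal_conf:
  assumes "i < N" "fires A \<pi> Eps (mode_state \<mu>, X) (mode_state \<mu>', X')"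
    and "\<And>j. j < N \<Longrightarrow> j \<noteq> i \<Longrightarrow> worker_state \<mu> (f j) = worker_state \<mu>' (f' j)"
  shows "discrete_step A \<pi> (conf N i \<mu> X f Y) (conf N i \<mu>' X' f' Y)"
  by (rule discrete_step.internal[where i = i]) (use assms in \<open>auto simp: nth_conf\<close>)

lemma discrete_send_conf:
  assumes "i < N" "fires A \<pi> (Send m) (mode_state \<mu>, X) (mode_state \<mu>', X')"
    and "\<And>j. j < N \<Longrightarrow> j \<noteq> i \<Longrightarrow> receives A \<pi> m (worker_state \<mu> (f j), Y) (worker_state \<mu>' (f' j), Y)"
  shows "discrete_step A \<pi> (conf N i \<mu> X f Y) (conf N i \<mu>' X' f' Y)"
  by (rule discrete_step.broadcast[where i = i and m = m]) (use assms in \<open>auto simp: nth_conf\<close>)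

lemma discrete_skip:
  assumes "i < N" "(q, Skip, q') \<in> T"
  shows "discrete_step A \<pi> (conf N i (Ctrl q) X f Y) (conf N i (Ctrl q') X f Y)"
proof (rule discrete_internal_conf)
  show "worker_state (Ctrl q) (f j) = worker_state (Ctrl q') (f j)" for j by (cases "f j") auto
qed (use assms in \<open>auto simp: fires_Ctrl\<close>)

lemma discrete_zero:
  assumes "i < N" "(q, IfZero r, q') \<in> T" "count N i f r = 0"
  shows "discrete_step A \<pi> (conf N i (Ctrl q) X f Y) (conf N i (Ctrl q') X f Y)"
proof (rule discrete_send_conf[where m = "msg_zero (Suc r)"])
  have "Suc r \<le> R" using T_regs[OF assms(2)] by simp
  then show "receives A \<pi> (msg_zero (Suc r)) (worker_state (Ctrl q) (f j), Y) (worker_state (Ctrl q') (f j), Y)"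
    if "j < N" "j \<noteq> i" for j
    unfolding receives_worker(2)[OF \<open>Suc r \<le> R\<close>, where q' = q']
    using count_zero_cong[OF assms(3) that] by simp
qed (use assms in \<open>auto simp: fires_Ctrl\<close>)

lemma step_move:
  assumes i: "i < N" and t: "move_trans T a b q q'" and k: "k < N" "k \<noteq> i" "f k = Some a"
  shows "(step A \<pi>)\<^sup>*\<^sup>* (conf N i (Ctrl q) X f Y) (conf N i (Ctrl q') X (f(k := Some b)) Y)"
proof -
  have ab: "a \<le> R" "b \<le> R" using move_trans_le[OF t] by auto
  have ok: "mode_ok (Wait a b q')" using t by auto
  have "(step A \<pi>)\<^sup>*\<^sup>* (conf N i (Ctrl q) X f Y) (conf N i (Wait a b q') X f Y)"
    by (intro r_into_rtranclp step_if_discrete discrete_send_conf[where m = "msg_move a b"])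
      (use i t in \<open>auto simp: fires_Ctrl receives_worker(3)[OF ab, where q' = q']\<close>)
  also have "step A \<pi> (conf N i (Wait a b q') X f Y) (conf N i (Ctrl q') X (f(k := Some b)) Y)"
  proof (intro step_if_discrete discrete_step.broadcast[where i = k and m = msg_chosen])
    show "fires A \<pi> (Send msg_chosen) (conf N i (Wait a b q') X f Y ! k)
        (conf N i (Ctrl q') X (f(k := Some b)) Y ! k)"
      using k fires_worker(3)[OF ok, of \<pi> msg_chosen "f k"] by (simp add: nth_conf)
    fix j assume j: "j < length (conf N i (Wait a b q') X f Y)" "j \<noteq> k"
    show "receives A \<pi> msg_chosen (conf N i (Wait a b q') X f Y ! j)
        (conf N i (Ctrl q') X (f(k := Some b)) Y ! j)"
    proof (cases "j = i")
      case True
      then show ?thesis using i receives_controller(1)[OF ok] by (simp add: nth_conf)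
    next
      case False
      then show ?thesis using j receives_worker(4)[OF ab, where q' = q'] by (simp add: nth_conf)
    qed
  qed (use k in auto)
  finally show ?thesis .
qed

text \<open>All the time of a cycle is spent here: the controller's clock is 0 before, and the delay
  is \<open>p\<close>, the longest that the guard allows.\<close>

lemma step_restart:
  assumes "i < N" "bounded f" "X 0 = 0" "0 \<le> \<pi> 0"
  shows "step A \<pi> (conf N i (Ctrl 1) X f Y)
    (conf N i (Ctrl 0) (reset {0} (\<lambda>x. X x + real_of_rat (\<pi> 0))) (\<lambda>j. map_option (\<lambda>_. 0) (f j))
      (\<lambda>x. Y x + real_of_rat (\<pi> 0)))"
  unfolding step_def
proof (intro exI conjI)
  show "0 \<le> real_of_rat (\<pi> 0)" using assms by simp
  show "discrete_step A \<pi> (delay (real_of_rat (\<pi> 0)) (conf N i (Ctrl 1) X f Y))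
    (conf N i (Ctrl 0) (reset {0} (\<lambda>x. X x + real_of_rat (\<pi> 0))) (\<lambda>j. map_option (\<lambda>_. 0) (f j))
      (\<lambda>x. Y x + real_of_rat (\<pi> 0)))"
    unfolding delay_conf
  proof (rule discrete_send_conf[where m = msg_restart])
    show "receives A \<pi> msg_restart (worker_state (Ctrl 1) (f j), \<lambda>x. Y x + real_of_rat (\<pi> 0))
        (worker_state (Ctrl 0) (map_option (\<lambda>_. 0) (f j)), \<lambda>x. Y x + real_of_rat (\<pi> 0))" for j
      using boundedD[OF assms(2)] by (subst receives_worker(1)[where q' = 0]) auto
    show "fires A \<pi> (Send msg_restart) (mode_state (Ctrl 1), \<lambda>x. X x + real_of_rat (\<pi> 0))
        (mode_state (Ctrl 0), reset {0} (\<lambda>x. X x + real_of_rat (\<pi> 0)))"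
      unfolding mode_state.simps fires_Ctrl using assms by simp
  qed (use assms in auto)
qed

text \<open>Pigeonhole: no worker is lost, so those not in a register are idle. The 2 stands for the
  controller and one worker to spare.\<close>

lemma idle_worker:
  assumes f: "\<And>j. f j \<noteq> None" "bounded f" and N: "N \<ge> 2 + (\<Sum>r<R. count N i f r)" and i: "i < N"
  shows "\<exists>k<N. k \<noteq> i \<and> f k = Some 0"
proof (rule ccontr)
  assume n: "\<not> ?thesis"
  have "{..<N} - {i} \<subseteq> (\<Union>r<R. {j. j < N \<and> j \<noteq> i \<and> f j = Some (Suc r)})"
  proof
    fix j assume j: "j \<in> {..<N} - {i}"
    then obtain a where a: "f j = Some a" "a \<le> R" using f boundedD by fastforce
    with n j have "a \<noteq> 0" by auto
    with a j show "j \<in> (\<Union>r<R. {j. j < N \<and> j \<noteq> i \<and> f j = Some (Suc r)})"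
      by (intro UN_I[of "a - 1"]) auto
  qed
  then have "card ({..<N} - {i}) \<le> card (\<Union>r<R. {j. j < N \<and> j \<noteq> i \<and> f j = Some (Suc r)})"
    by (intro card_mono) auto
  also have "\<dots> \<le> (\<Sum>r<R. count N i f r)"
    unfolding count_def by (rule card_UN_le) simp
  finally show False using N i by simp
qed

text \<open>The network size depends on the run only, through the largest total of the registers
  before a step; it is the same for all \<pi>, since the simulation within a cycle takes no time and
  meets no guard.\<close>

lemma simulate_run:
  assumes "(gstep T)\<^sup>*\<^sup>* (0, \<lambda>_. 0) (q, s)"
  shows "\<exists>N0\<ge>2. \<forall>N\<ge>N0. \<exists>f. (\<forall>j. f j \<noteq> None) \<and> bounded f \<and> count N 0 f = s \<and>
    (\<forall>\<pi> X Y. (step A \<pi>)\<^sup>*\<^sup>* (conf N 0 (Ctrl 0) X (\<lambda>_. Some 0) Y) (conf N 0 (Ctrl q) X f Y))"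
  using assms
proof (induction "(q, s)" arbitrary: q s rule: rtranclp_induct)
  case base
  have "count N 0 (\<lambda>_. Some 0) = (\<lambda>_. 0)" for N by (auto simp: count_def)
  \<comment> \<open>Size 2 for the controller and the worker that finally announces the
    time.\<close>
  then show ?case by (intro exI[of _ 2]) (auto simp: bounded_def intro!: exI[of _ "\<lambda>_. Some 0"])
next
  case (step b q' s')
  obtain q s where b: "b = (q, s)" by (cases b)
  obtain N0 where N0: "N0 \<ge> 2" "\<And>N. N \<ge> N0 \<Longrightarrow> \<exists>f. (\<forall>j. f j \<noteq> None) \<and> bounded f \<and> count N 0 f = s \<and>
    (\<forall>\<pi> X Y. (step A \<pi>)\<^sup>*\<^sup>* (conf N 0 (Ctrl 0) X (\<lambda>_. Some 0) Y) (conf N 0 (Ctrl q) X f Y))"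
    using step(3)[OF b] by blast
  obtain \<alpha> where \<alpha>: "(q, \<alpha>, q') \<in> T" "exec \<alpha> s s'"
    using step(2) b by (auto simp: gstep_def)
  let ?N1 = "max N0 (2 + (\<Sum>r<R. s r))"
  have "\<exists>f. (\<forall>j. f j \<noteq> None) \<and> bounded f \<and> count N 0 f = s' \<and>
      (\<forall>\<pi> X Y. (step A \<pi>)\<^sup>*\<^sup>* (conf N 0 (Ctrl 0) X (\<lambda>_. Some 0) Y) (conf N 0 (Ctrl q') X f Y))"
    if N: "N \<ge> ?N1" for N
  proof -
    obtain f where f: "\<And>j. f j \<noteq> None" "bounded f" "count N 0 f = s"
      "\<And>\<pi> X Y. (step A \<pi>)\<^sup>*\<^sup>* (conf N 0 (Ctrl 0) X (\<lambda>_. Some 0) Y) (conf N 0 (Ctrl q) X f Y)"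
      using N0(2)[of N] N by auto
    have "0 < N" using N by simp
    obtain f' where f': "\<And>j. f' j \<noteq> None" "bounded f'" "count N 0 f' = s'"
      "\<And>\<pi> X Y. (step A \<pi>)\<^sup>*\<^sup>* (conf N 0 (Ctrl q) X f Y) (conf N 0 (Ctrl q') X f' Y)"
    \<comment> \<open>The first case covers increments and decrements; in the second they are
      contradictory, which leaves the instructions that keep the store.\<close>
    proof (cases "\<exists>a b. move_trans T a b q q' \<and> (\<exists>k<N. k \<noteq> 0 \<and> f k = Some a \<and> count N 0 (f(k := Some b)) = s')")
      case True
      then obtain a b k where k: "move_trans T a b q q'" "k < N" "k \<noteq> 0" "f k = Some a"
        "count N 0 (f(k := Some b)) = s'" by blast
      show thesis
        using that[of "f(k := Some b)"] step_move[of 0 N a b q q' k f, OF \<open>0 < N\<close> k(1-4)] k(5) f(1,2) move_trans_le[OF k(1)]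
        by (auto simp: bounded_def)
    next
      case False
      have "s' = s \<and> (\<forall>\<pi> X Y. discrete_step A \<pi> (conf N 0 (Ctrl q) X f Y) (conf N 0 (Ctrl q') X f Y))"
      proof (cases \<alpha>)
        case Skip
        then show ?thesis using \<alpha> discrete_skip[OF \<open>0 < N\<close>] by simp
      next
        case (IfZero r)
        then show ?thesis using \<alpha> discrete_zero[OF \<open>0 < N\<close>, of q r q' f] f(3) by simp
      next
        case (Inc r)
        obtain k where k: "k < N" "k \<noteq> 0" "f k = Some 0"
          using idle_worker[OF f(1,2), of N 0] f(3) N \<open>0 < N\<close> by auto
        have "move_trans T 0 (Suc r) q q'" using \<alpha> Inc by (simp add: move_transI)
        moreover have "count N 0 (f(k := Some (Suc r))) = s'"
          using count_Inc[of k N 0 f, OF k] \<alpha> Inc f(3) by simp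
        ultimately show ?thesis using False k by blast
      next
        case (Dec r)
        then have "count N 0 f r > 0" using \<alpha> f(3) by simp
        then obtain k where k: "k < N" "k \<noteq> 0" "f k = Some (Suc r)"
          by (auto simp: count_def card_gt_0_iff)
        have "move_trans T (Suc r) 0 q q'" using \<alpha> Dec by (simp add: move_transI)
        moreover have "count N 0 (f(k := Some 0)) = s'"
          using count_Dec[of k N 0 f, OF k] \<alpha> Dec f(3) by simp
        ultimately show ?thesis using False k by blast
      qed
      then show thesis using that[of f] f(1-3) step_if_discrete by (meson r_into_rtranclp)
    qed
    show ?thesis
      using f(4) f' by (intro exI[of _ f']) (meson rtranclp_trans)
  qed
  moreover have "?N1 \<ge> 2" by simp
  ultimately show ?case by blast
qed

lemma step_start:
  assumes "0 < N"
  shows "step A \<pi> (initial_config A N) (conf N 0 (Ctrl 0) (\<lambda>_. 0) (\<lambda>_. Some 0) (\<lambda>_. 0))"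
  unfolding step_def
proof (intro exI[of _ 0] conjI)
  show "discrete_step A \<pi> (delay 0 (initial_config A N))
      (conf N 0 (Ctrl 0) (\<lambda>_. 0) (\<lambda>_. Some 0) (\<lambda>_. 0))"
    unfolding delay_initial
    by (rule discrete_step.broadcast[where i = 0 and m = msg_start])
      (use assms in \<open>auto simp: nth_conf fires_idle receives_idle\<close>)
qed simp

lemma step_final:
  assumes "2 \<le> N" "X 0 \<le> real_of_rat (\<pi> 0)" "1 \<le> Y 0"
  shows "\<exists>c. step A \<pi> (conf N 0 (Ctrl 0) X (\<lambda>_. Some 0) Y) c \<and> final \<in> fst ` set c"
proof (intro exI conjI)
  let ?c = "(conf N 0 (Ctrl 0) X (\<lambda>_. Some 0) Y)[0 := (final, X), 1 := (lost, Y)]"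
  show "step A \<pi> (conf N 0 (Ctrl 0) X (\<lambda>_. Some 0) Y) ?c"
  proof (intro step_if_discrete discrete_step.broadcast[where i = 1 and m = msg_time])
    show "fires A \<pi> (Send msg_time) (conf N 0 (Ctrl 0) X (\<lambda>_. Some 0) Y ! 1) (?c ! 1)"
      using assms fires_worker(2)[of \<pi> msg_time 0 "Some 0"] by (simp add: nth_conf)
    fix j assume j: "j < length (conf N 0 (Ctrl 0) X (\<lambda>_. Some 0) Y)" "j \<noteq> 1"
    show "receives A \<pi> msg_time (conf N 0 (Ctrl 0) X (\<lambda>_. Some 0) Y ! j) (?c ! j)"
    proof (cases "j = 0")
      case True
      then show ?thesis using assms by (simp add: nth_conf receives_controller(2))
    next
      case False
      then show ?thesis using j receives_worker(5)[of \<pi> "Ctrl 0" "Some 0" Y] by (simp add: nth_conf)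
    qed
  qed (use assms in auto)
  have "?c ! 0 = (final, X)" "0 < length ?c" using assms by auto
  then show "final \<in> fst ` set ?c" by (metis fst_conv image_eqI nth_mem)
qed

lemma universal:
  assumes "halts"
  shows "exists_EF_universal (A, \<lambda>_. LeftOpenIv 0 1, final)"
proof -
  obtain s where "(gstep T)\<^sup>*\<^sup>* (0, \<lambda>_. 0) (1, s)" using assms by (auto simp: halts_def)
  from simulate_run[OF this] obtain N f where N: "N \<ge> 2"
    and f: "\<And>j. f j \<noteq> None" "bounded f"
      "\<And>\<pi> X Y. (step A \<pi>)\<^sup>*\<^sup>* (conf N 0 (Ctrl 0) X (\<lambda>_. Some 0) Y) (conf N 0 (Ctrl 1) X f Y)"
    by blast
  have "\<exists>\<rho> \<in> executions A N \<pi>. reaches \<rho> final" if \<pi>: "\<pi> \<in> valuations_in A (\<lambda>_. LeftOpenIv 0 1)" for \<pi>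
  proof -
    let ?p = "real_of_rat (\<pi> 0)"
    have p: "0 < \<pi> 0" using \<pi> by (simp add: valuations_in_def protocol_def)
    \<comment> \<open>A restart makes all workers idle again, so the network size sufficient for one
      cycle suffices for any number of them.\<close>
    have cycles: "\<exists>X Y. X 0 = 0 \<and> Y 0 = real n * ?p \<and>
        (step A \<pi>)\<^sup>*\<^sup>* (initial_config A N) (conf N 0 (Ctrl 0) X (\<lambda>_. Some 0) Y)" for n
    proof (induction n)
      case 0
      show ?case using step_start[of N \<pi>] N
        by (intro exI[of _ "\<lambda>_. 0"] exI[of _ "\<lambda>_. 0"]) auto
    next
      case (Suc n)
      then obtain X Y where X: "X 0 = 0" "Y 0 = real n * ?p"
        "(step A \<pi>)\<^sup>*\<^sup>* (initial_config A N) (conf N 0 (Ctrl 0) X (\<lambda>_. Some 0) Y)" by blast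
      let ?X = "reset {0} (\<lambda>x. X x + ?p)" and ?Y = "\<lambda>x. Y x + ?p"
      have "(\<lambda>j. map_option (\<lambda>_. 0) (f j)) = (\<lambda>_. Some 0 :: nat option)" using f(1) by auto
      then have "step A \<pi> (conf N 0 (Ctrl 1) X f Y) (conf N 0 (Ctrl 0) ?X (\<lambda>_. Some 0) ?Y)"
        using step_restart[of 0 N f X \<pi> Y] N f(2) X(1) p by simp
      then have "(step A \<pi>)\<^sup>*\<^sup>* (initial_config A N) (conf N 0 (Ctrl 0) ?X (\<lambda>_. Some 0) ?Y)"
        using X(3) f(3)[of \<pi> X Y] by (meson rtranclp.rtrancl_into_rtrancl rtranclp_trans)
      moreover have "?X 0 = 0" "?Y 0 = real (Suc n) * ?p"
        using X by (auto simp: reset_def algebra_simps)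
      ultimately show ?case by (intro exI[of _ ?X] exI[of _ ?Y] conjI)
    qed
    have "0 < ?p" using p by simp
    \<comment> \<open>Only the number of cycles depends on \<open>p\<close>; it is finite because 0
      is not in the interval.\<close>
    then obtain n where n: "1 < real n * ?p" using reals_Archimedean3 by blast
    obtain X Y where X: "X 0 = 0" "Y 0 = real n * ?p"
      "(step A \<pi>)\<^sup>*\<^sup>* (initial_config A N) (conf N 0 (Ctrl 0) X (\<lambda>_. Some 0) Y)"
      using cycles[of n] by blast
    have "\<exists>c. step A \<pi> (conf N 0 (Ctrl 0) X (\<lambda>_. Some 0) Y) c \<and> final \<in> fst ` set c"
      by (rule step_final) (use N n X p in auto)
    then obtain c where "step A \<pi> (conf N 0 (Ctrl 0) X (\<lambda>_. Some 0) Y) c" "final \<in> fst ` set c"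
      by blast
    with X(3) show ?thesis
      unfolding reaches_iff_reachable by (meson rtranclp.rtrancl_into_rtrancl)
  qed
  then show ?thesis by auto
qed

theorem universal_iff_halts: "exists_EF_universal (A, \<lambda>_. LeftOpenIv 0 1, final) \<longleftrightarrow> halts"
  using universal not_universal by blast

end

section \<open>The instance of a program run on its own code\<close>

text \<open>Control states 0, 1 and 2 are the start, the halt and the entry of the program; the states
  \<open>d, \<dots>, 2 * d\<close> load \<open>d\<close> into register 0.\<close>

definition loader :: "nat \<Rightarrow> nat graph" where
  "loader d = {(0, Skip, d), (d + d, Skip, 2)} \<union> (\<lambda>i. (d + i, Inc 0, Suc (d + i))) ` {..<d}"

text \<open>The largest name is that of \<open>wait (d + d)\<close>, the waiting state of the last
  increment of the loader.\<close>

definition state_bound :: "nat \<Rightarrow> nat" where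
  "state_bound d = Suc (prod_encode (1, d + d))"

text \<open>The code of an edge with empty guard and empty reset set, both of which have set code
  0.\<close>

definition plain_code :: "nat \<Rightarrow> nat action \<Rightarrow> nat \<Rightarrow> nat" where
  "plain_code q a q' = list_encode [q, 0, encode_action a, 0, q']"

text \<open>The set code of the edges of the loader, written so that it is visibly recursive in
  \<open>d\<close>. Place 1 holds register 0.\<close>

definition loader_code :: "nat \<Rightarrow> nat" where
  "loader_code d = 2 ^ plain_code (ctrl 0) Eps (ctrl d) + 2 ^ plain_code (ctrl (d + d)) Eps (ctrl 2) +
    (\<Sum>i<d. 2 ^ plain_code (ctrl (d + i)) (Send (msg_move 0 1)) (wait (Suc (d + i)))) +
    (\<Sum>i<d. 2 ^ plain_code (wait (Suc (d + i))) (Recv msg_chosen) (ctrl (Suc (d + i))))"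

text \<open>Set codes are additive on disjoint sets, whence the entry for the edges:
  \<open>d\<close> stands for all edges but those of the loader.\<close>

definition instance_code :: "nat \<Rightarrow> nat" where
  "instance_code d = list_encode [\<Sum>i<state_bound d. 2 ^ i, set_encode {0}, \<Sum>i<state_bound d. 2 ^ i,
     set_encode {0}, idle, d + loader_code d,
     set_encode {prod_encode (0, encode_interval (LeftOpenIv 0 1))}, final]"

lemma recursive_plain_code:
  assumes "recursive k A" "recursive k B"
  shows "recursive k (\<lambda>xs. plain_code (A xs) a (B xs))"
  unfolding plain_code_def by (intro recursive_intros assms)

lemma recursive_instance_code: "recursive (Suc 0) (\<lambda>xs. instance_code (xs ! 0))"
proof -
  have states: "recursive (Suc 0) (\<lambda>xs. \<Sum>i<state_bound (xs ! 0). 2 ^ i)"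
    unfolding state_bound_def
    by (rule recursive_sum[where G = "\<lambda>i _. 2 ^ i" and B = "\<lambda>xs. xs ! 0"]) (intro recursive_intros; simp)+
  have send: "recursive (Suc 0) (\<lambda>xs. \<Sum>i<xs ! 0.
      2 ^ plain_code (ctrl (xs ! 0 + i)) (Send (msg_move 0 1)) (wait (Suc (xs ! 0 + i))))"
    by (rule recursive_sum[where B = "\<lambda>xs. xs ! 0"
        and G = "\<lambda>i d. 2 ^ plain_code (ctrl (d + i)) (Send (msg_move 0 1)) (wait (Suc (d + i)))"])
      (intro recursive_intros recursive_plain_code; simp)+
  have recv: "recursive (Suc 0) (\<lambda>xs. \<Sum>i<xs ! 0.
      2 ^ plain_code (wait (Suc (xs ! 0 + i))) (Recv msg_chosen) (ctrl (Suc (xs ! 0 + i))))"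
    by (rule recursive_sum[where B = "\<lambda>xs. xs ! 0"
        and G = "\<lambda>i d. 2 ^ plain_code (wait (Suc (d + i))) (Recv msg_chosen) (ctrl (Suc (d + i)))"])
      (intro recursive_intros recursive_plain_code; simp)+
  show ?thesis
    unfolding instance_code_def loader_code_def
    by (intro recursive_intros recursive_plain_code states send recv; simp)
qed

section \<open>Size bounds on codes, for fresh names\<close>

lemma list_encode_ge: "x \<in> set xs \<Longrightarrow> x \<le> list_encode xs"
proof (induction xs)
  case (Cons y xs)
  have "y \<le> prod_encode (y, list_encode xs)" "list_encode xs \<le> prod_encode (y, list_encode xs)"
    by (rule le_prod_encode_1, rule le_prod_encode_2)
  then show ?case using Cons by auto
qed simp

lemma set_encode_greater:
  assumes "finite A" "x \<in> A" shows "x < set_encode A"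
proof -
  have "x < 2 ^ x" by (rule less_exp)
  also have "2 ^ x \<le> set_encode A"
    unfolding set_encode_def using assms by (intro member_le_sum) auto
  finally show ?thesis .
qed

lemma prod_encode_mono:
  assumes "a \<le> c" "b \<le> d" shows "prod_encode (a, b) \<le> prod_encode (c, d)"
proof -
  have "triangle x \<le> triangle (x + y)" for x y by (induction y) auto
  from this[of "a + b" "c + d - (a + b)"] show ?thesis using assms by (simp add: prod_encode_def)
qed

lemma encode_edge_ge:
  "q \<le> encode_edge (q, g, a, U, q')" "q' \<le> encode_edge (q, g, a, U, q')"
  "encode_action a \<le> encode_edge (q, g, a, U, q')"
  unfolding encode_edge.simps by (rule list_encode_ge; simp)+

lemma message_le_encode_action: "m \<le> encode_action (Send m)" "m \<le> encode_action (Recv m)"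
  by (auto simp: sum_encode_def)

text \<open>With the next lemma: every control point except the halting one has an outgoing edge,
  whose code then bounds its name.\<close>

lemma conts_not_Nil: "k \<in> conts c l \<Longrightarrow> k \<noteq> []"
  by (induction c arbitrary: l) auto

lemma succs_not_empty: "k \<noteq> [] \<Longrightarrow> succs k \<noteq> {}"
  by (cases k rule: succs.cases) auto

lemma finite_main_edges: "finite main_edges"
  by (simp add: main_edges_def)

lemma finite_worker_edges: "finite (worker_edges R)"
  unfolding worker_edges_def by (intro finite_UnI finite_UN_I) auto

lemma finite_trans_edges: "finite (trans_edges t)"
  by (cases t rule: trans_edges.cases) (auto simp: move_edges_def)

text \<open>\<open>h\<close> names the control points. The names 1 and 2 are fixed for halting and
  entry, and 0 is left to the start of the loader.\<close>

locale program =
  fixes C :: prog and h :: "prog list \<Rightarrow> nat"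
  assumes h_inj: "inj_on h (insert [] (conts C []))"
    and h_Nil: "h [] = 1" and h_start: "h [C] = 2" and h_pos: "0 < h k"
begin

text \<open>0 is inserted because the loader fills register 0, whatever the program uses.\<close>

definition reg_bound :: nat where
  "reg_bound = Suc (Max (insert 0 (regs C)))"

definition body :: "nat graph" where
  "body = (\<lambda>(k, \<alpha>, k'). (h k, \<alpha>, h k')) ` cont_graph C"

definition body_edges :: "nat_edge set" where
  "body_edges = main_edges \<union> worker_edges reg_bound \<union> (\<Union>t \<in> body. trans_edges t)"

definition d :: nat where
  "d = set_encode (encode_edge ` body_edges)"

abbreviation "graph \<equiv> body \<union> loader d"

lemma body_iff: "(q, \<alpha>, q') \<in> body \<longleftrightarrow>
    (\<exists>k k'. q = h k \<and> q' = h k' \<and> k \<in> conts C [] \<and> (\<alpha>, k') \<in> succs k)"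
  by (force simp: body_def cont_graph_def)

lemma finite_body: "finite body"
  unfolding body_def using finite_cont_graph by blast

lemma finite_body_edges: "finite body_edges"
  unfolding body_edges_def
  by (intro finite_UnI finite_UN_I finite_main_edges finite_worker_edges finite_body finite_trans_edges)

sublocale simulation graph reg_bound "state_bound d"
proof
  fix q \<alpha> q' r assume "(q, \<alpha>, q') \<in> graph" "r \<in> instr_regs \<alpha>"
  then have "r \<in> insert 0 (regs C)"
  proof (elim UnE)
    assume "(q, \<alpha>, q') \<in> body"
    then show ?thesis using conts_regs \<open>r \<in> instr_regs \<alpha>\<close> by (fastforce simp: body_iff)
  next
    assume "(q, \<alpha>, q') \<in> loader d"
    then show ?thesis using \<open>r \<in> instr_regs \<alpha>\<close> by (auto simp: loader_def)
  qed
  then show "r < reg_bound"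
    unfolding reg_bound_def using Max_ge[of "insert 0 (regs C)" r] finite_regs by (simp add: less_Suc_eq_le)
qed

text \<open>The source of all freshness: every state or message in a body edge is at most the code
  of the edge, hence below \<open>d\<close>.\<close>

lemma code_less: "e \<in> body_edges \<Longrightarrow> encode_edge e < d"
  unfolding d_def using finite_body_edges by (intro set_encode_greater) auto

lemma body_edge_less:
  assumes "(q, g, a, U, q') \<in> body_edges"
  shows "q < d" "q' < d" "encode_action a < d"
  using code_less[OF assms] encode_edge_ge le_less_trans by blast+

lemma body_edge_action:
  assumes "(q, g, a, U, q') \<in> body_edges"
  shows "a \<in> actions_over {..<d}"
proof (cases a)
  case (Send m)
  then show ?thesis
    using body_edge_less(3)[OF assms] message_le_encode_action(1)[of m] by (simp add: actions_over_def)
next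
  case (Recv m)
  then show ?thesis
    using body_edge_less(3)[OF assms] message_le_encode_action(2)[of m]
    by (simp add: actions_over_def image_iff)
qed (simp add: actions_over_def)

lemma body_less:
  assumes "(q, \<alpha>, q') \<in> body" shows "q < d"
proof -
  obtain g a U p where "(ctrl q, g, a, U, p) \<in> trans_edges (q, \<alpha>, q')"
    by (cases \<alpha>) (auto simp: move_edges_def)
  then have "(ctrl q, g, a, U, p) \<in> body_edges" using assms by (auto simp: body_edges_def)
  then have "ctrl q < d" by (rule body_edge_less)
  then show ?thesis using le_prod_encode_2[of q 0] by simp
qed

text \<open>A control point is bounded through a program edge leaving it; the halting point, which
  has none, through the restart edge from \<open>ctrl 1\<close>.\<close>

lemma h_less:
  assumes "k \<in> insert [] (conts C [])" shows "h k < d"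
proof (cases "k = []")
  case True
  have "(ctrl 1, {(0, Le, Param 0)}, Send msg_restart, {0}, ctrl 0) \<in> body_edges"
    by (simp add: body_edges_def main_edges_def)
  from body_edge_less(1)[OF this] show ?thesis
    using True h_Nil le_prod_encode_2[of 1 0] by simp
next
  case False
  then obtain \<alpha> k' where "(\<alpha>, k') \<in> succs k" using succs_not_empty by fastforce
  then have "(h k, \<alpha>, h k') \<in> body" using False assms by (auto simp: body_iff)
  then show ?thesis by (rule body_less)
qed

lemma d_pos: "0 < d"
  using h_less[of "[]"] by simp

text \<open>The three phases cannot mix: the start is 0, program points lie strictly between 0 and
  \<open>d\<close>, loader points from \<open>d\<close> to \<open>2 * d\<close>. So only edges of
  the current phase apply, and as \<open>h\<close> is injective the program phase is a run of
  \<open>cont_graph C\<close>.\<close>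

lemma run_sound:
  assumes "(gstep graph)\<^sup>*\<^sup>* (0, \<lambda>_. 0) (q, s)"
  shows "q = 0 \<and> s = (\<lambda>_. 0) \<or> (\<exists>i\<le>d. q = d + i \<and> s = (\<lambda>_. 0)(0 := i)) \<or>
    (\<exists>k \<in> insert [] (conts C []). q = h k \<and>
      (gstep (cont_graph C))\<^sup>*\<^sup>* ([C], (\<lambda>_. 0)(0 := d)) (k, s))"
  using assms
proof (induction "(q, s)" arbitrary: q s rule: rtranclp_induct)
  case base
  show ?case by simp
next
  case (step b q' s')
  obtain q s where b: "b = (q, s)" by (cases b)
  obtain \<alpha> where \<alpha>: "(q, \<alpha>, q') \<in> graph" "exec \<alpha> s s'"
    using step(2) b by (auto simp: gstep_def)
  from step(3)[OF b] consider
      (start) "q = 0" "s = (\<lambda>_. 0)"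
    | (load) i where "i \<le> d" "q = d + i" "s = (\<lambda>_. 0)(0 := i)"
    | (run) k where "k \<in> insert [] (conts C [])" "q = h k"
        "(gstep (cont_graph C))\<^sup>*\<^sup>* ([C], (\<lambda>_. 0)(0 := d)) (k, s)"
    by blast
  then show ?case
  proof cases
    case start
    then have "(q, \<alpha>, q') \<notin> body" using h_pos by (auto simp: body_iff)
    then have "\<alpha> = Skip" "q' = d" using \<alpha> start d_pos by (auto simp: loader_def)
    then have "q' = d + 0" "s' = (\<lambda>_. 0)(0 := 0)" using \<alpha> start by auto
    then show ?thesis by blast
  next
    case load
    then have "(q, \<alpha>, q') \<notin> body" using body_less by fastforce
    then consider "i = d" "\<alpha> = Skip" "q' = 2" | "i < d" "\<alpha> = Inc 0" "q' = d + Suc i"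
      using \<alpha> load d_pos by (auto simp: loader_def)
    then show ?thesis
    proof cases
      case 1
      then have "q' = h [C]" "s' = (\<lambda>_. 0)(0 := d)" using \<alpha> load h_start by auto
      moreover have "[C] \<in> conts C []" by (rule cont_self)
      ultimately show ?thesis by blast
    next
      case 2
      then have "s' = (\<lambda>_. 0)(0 := Suc i)" using \<alpha> load by (auto simp: fun_eq_iff)
      then show ?thesis using 2 by (intro disjI2 disjI1 exI[of _ "Suc i"]) auto
    qed
  next
    case run
    have "q < d" "q > 0" using h_less run h_pos by auto
    then have "(q, \<alpha>, q') \<in> body" using \<alpha> by (auto simp: loader_def)
    then obtain l k' where l: "q = h l" "q' = h k'" "l \<in> conts C []" "(\<alpha>, k') \<in> succs l"
      by (auto simp: body_iff)
    then have "l = k" using h_inj run by (auto dest: inj_onD)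
    then have "gstep (cont_graph C) (k, s) (k', s')"
      using l \<alpha> by (auto simp: gstep_def cont_graph_def)
    moreover have "k' \<in> insert [] (conts C [])" using conts_closed l by blast
    moreover have "(gstep (cont_graph C))\<^sup>*\<^sup>* ([C], (\<lambda>_. 0)(0 := d)) (k', s')"
      using run(3) calculation(1) by (rule rtranclp.rtrancl_into_rtrancl)
    ultimately show ?thesis using l(2) by blast
  qed
qed

lemma run_complete:
  assumes "(gstep (cont_graph C))\<^sup>*\<^sup>* ([C], s) (k, s')"
  shows "(gstep graph)\<^sup>*\<^sup>* (2, s) (h k, s')"
  using assms
proof (induction "(k, s')" arbitrary: k s' rule: rtranclp_induct)
  case base
  show ?case by (simp add: h_start)
next
  case (step b k' s')
  obtain l u where b: "b = (l, u)" by (cases b)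
  from step(2) b obtain \<alpha> where "(l, \<alpha>, k') \<in> cont_graph C" "exec \<alpha> u s'"
    by (auto simp: gstep_def)
  then have "(h l, \<alpha>, h k') \<in> body" "exec \<alpha> u s'" by (auto simp: body_iff cont_graph_def)
  then have "gstep graph (h l, u) (h k', s')" by (auto simp: gstep_def)
  then show ?case using step(3)[OF b] by (rule rtranclp.rtrancl_into_rtrancl[rotated])
qed

lemma run_load:
  "i \<le> d \<Longrightarrow> (gstep graph)\<^sup>*\<^sup>* (0, \<lambda>_. 0) (d + i, (\<lambda>_. 0)(0 := i))"
proof (induction i)
  case 0
  have "gstep graph (0, \<lambda>_. 0) (d, \<lambda>_. 0)"
    by (auto simp: gstep_def loader_def intro!: exI[of _ Skip])
  moreover have "(\<lambda>_. 0)(0 := 0) = (\<lambda>_. 0 :: nat)" by auto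
  ultimately show ?case by (simp add: r_into_rtranclp)
next
  case (Suc i)
  have "(d + i, Inc 0, Suc (d + i)) \<in> graph" using Suc.prems by (auto simp: loader_def)
  moreover have "exec (Inc 0) ((\<lambda>_. 0)(0 := i)) ((\<lambda>_. 0)(0 := Suc i))" by (auto simp: fun_eq_iff)
  ultimately have "gstep graph (d + i, (\<lambda>_. 0)(0 := i)) (d + Suc i, (\<lambda>_. 0)(0 := Suc i))"
    unfolding gstep_def fst_conv snd_conv add_Suc_right by blast
  then show ?case using Suc by (meson Suc_leD rtranclp.rtrancl_into_rtrancl)
qed

lemma halts_iff: "halts \<longleftrightarrow> (\<exists>s. ((\<lambda>_. 0)(0 := d), s) \<in> sem C)"
proof
  assume halts
  then obtain s where "(gstep graph)\<^sup>*\<^sup>* (0, \<lambda>_. 0) (1, s)" by (auto simp: halts_def)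
  from run_sound[OF this] show "\<exists>s. ((\<lambda>_. 0)(0 := d), s) \<in> sem C"
  proof (elim disjE exE conjE bexE)
    fix i assume "1 = d + i"
    then show ?thesis using h_less[of "[]"] h_Nil by simp
  next
    fix k assume k: "k \<in> insert [] (conts C [])" "1 = h k"
      "(gstep (cont_graph C))\<^sup>*\<^sup>* ([C], (\<lambda>_. 0)(0 := d)) (k, s)"
    have "h k = h []" using k(2) h_Nil by simp
    then have "k = []" using inj_onD[OF h_inj _ k(1)] by simp
    then show ?thesis using k(3) cont_graph_correct by blast
  qed simp
next
  assume "\<exists>s. ((\<lambda>_. 0)(0 := d), s) \<in> sem C"
  then obtain s where "(gstep (cont_graph C))\<^sup>*\<^sup>* ([C], (\<lambda>_. 0)(0 := d)) ([], s)"
    using cont_graph_correct by blast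
  from run_complete[OF this] have "(gstep graph)\<^sup>*\<^sup>* (2, (\<lambda>_. 0)(0 := d)) (1, s)"
    by (simp add: h_Nil)
  moreover have "gstep graph (d + d, (\<lambda>_. 0)(0 := d)) (2, (\<lambda>_. 0)(0 := d))"
    by (auto simp: gstep_def loader_def intro!: exI[of _ Skip])
  ultimately show halts
    unfolding halts_def using run_load[of d] by (meson converse_rtranclp_into_rtranclp order_refl rtranclp_trans)
qed

section \<open>The code of the instance\<close>

definition loader_edges :: "nat_edge set" where
  "loader_edges = {(ctrl 0, {}, Eps, {}, ctrl d), (ctrl (d + d), {}, Eps, {}, ctrl 2)} \<union>
    (\<lambda>i. (ctrl (d + i), {}, Send (msg_move 0 1), {}, wait (Suc (d + i)))) ` {..<d} \<union>
    (\<lambda>i. (wait (Suc (d + i)), {}, Recv msg_chosen, {}, ctrl (Suc (d + i)))) ` {..<d}"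

lemma edges_eq: "edges A = body_edges \<union> loader_edges"
proof -
  have "(\<Union>t \<in> loader d. trans_edges t) = loader_edges"
    by (auto simp: loader_def loader_edges_def move_edges_def)
  then show ?thesis by (auto simp: protocol_def body_edges_def)
qed

text \<open>The sum over the set splits because the codes are distinct; \<open>d > 0\<close> keeps
  the first and the last \<open>Skip\<close> edge apart.\<close>

lemma set_encode_loader: "set_encode (encode_edge ` loader_edges) = loader_code d"
proof -
  let ?s = "\<lambda>i. plain_code (ctrl (d + i)) (Send (msg_move 0 1)) (wait (Suc (d + i)))"
  let ?r = "\<lambda>i. plain_code (wait (Suc (d + i))) (Recv msg_chosen) (ctrl (Suc (d + i)))"
  let ?a = "plain_code (ctrl 0) Eps (ctrl d)" and ?b = "plain_code (ctrl (d + d)) Eps (ctrl 2)"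
  have eq: "encode_edge ` loader_edges = ({?a, ?b} \<union> ?s ` {..<d}) \<union> ?r ` {..<d}"
    by (simp add: loader_edges_def plain_code_def image_Un image_image del: list_encode.simps)
  have inj: "plain_code q a q' = plain_code p b p' \<longleftrightarrow> q = p \<and> encode_action a = encode_action b \<and> q' = p'"
    for q a q' p b p'
    unfolding plain_code_def by (simp add: list_encode_eq del: list_encode.simps)
  have "?a \<noteq> ?b" using d_pos by (simp add: inj)
  moreover have "({?a, ?b} \<union> ?s ` {..<d}) \<inter> ?r ` {..<d} = {}" by (auto simp: inj)
  moreover have "{?a, ?b} \<inter> ?s ` {..<d} = {}" using d_pos by (auto simp: inj)
  moreover have "inj_on ?s {..<d}" "inj_on ?r {..<d}" by (auto simp: inj_on_def inj)
  ultimately show ?thesis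
    unfolding eq set_encode_def loader_code_def
    by (simp add: sum.union_disjoint sum.reindex del: Un_insert_left)
qed

text \<open>Each loader edge mentions a state numbered from \<open>d\<close> on, and codes dominate
  their components. Together with \<open>code_less\<close> this separates the codes of the two
  groups of edges.\<close>

lemma loader_code_ge: "e \<in> loader_edges \<Longrightarrow> d \<le> encode_edge e"
proof -
  assume e: "e \<in> loader_edges"
  have "\<exists>q g a U q'. e = (q, g, a, U, q') \<and> (d \<le> q \<or> d \<le> q')"
  proof -
    have "x \<le> prod_encode (a, x)" for a x by (rule le_prod_encode_2)
    then have "d \<le> prod_encode (a, d + i)" "d \<le> prod_encode (a, d)" for a i
      by (meson le_add1 le_trans)+
    from this(1)[of _ "Suc _"] this show ?thesis using e unfolding loader_edges_def
      by fastforce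
  qed
  then show ?thesis using encode_edge_ge(1,2) le_trans by blast
qed

lemma set_encode_edges: "set_encode (encode_edge ` edges A) = d + loader_code d"
proof -
  have "encode_edge ` body_edges \<inter> encode_edge ` loader_edges = {}"
    using code_less loader_code_ge by (fastforce simp: disjoint_iff)
  moreover have "finite loader_edges" by (simp add: loader_edges_def)
  ultimately have "set_encode (encode_edge ` edges A) =
      set_encode (encode_edge ` body_edges) + set_encode (encode_edge ` loader_edges)"
    unfolding edges_eq image_Un set_encode_def using finite_body_edges by (intro sum.union_disjoint) auto
  then show ?thesis by (simp add: set_encode_loader d_def)
qed

lemma encode_protocol: "encode_instance (A, \<lambda>_. LeftOpenIv 0 1, final) = instance_code d"
proof -
  have "set_encode {..<K} = (\<Sum>i<K. 2 ^ i)" for K by (simp add: set_encode_def)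
  then show ?thesis
    using set_encode_edges unfolding encode_instance.simps instance_code_def
    by (simp add: protocol_def del: list_encode.simps encode_interval.simps)
qed

section \<open>Membership of the instance in the problem class\<close>

lemma state_bound_ge: "d \<le> state_bound d" "i \<le> d \<Longrightarrow> ctrl (d + i) < state_bound d"
    "i \<le> d \<Longrightarrow> wait (d + i) < state_bound d"
  using le_prod_encode_2[of "d + d" 1] prod_encode_mono[of 0 1 "d + i" "d + d"]
    prod_encode_mono[of 1 1 "d + i" "d + d"]
  by (auto simp: state_bound_def)

lemma edge_shape:
  assumes "(q, g, a, U, q') \<in> edges A"
  shows "g \<in> {{}, {(0, Le, Const 0)}, {(0, Ge, Const 1)}, {(0, Le, Param 0)}}" "U \<subseteq> {0}"
  using assms by (auto simp: edge_simps)

lemma edge_bounds: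
  assumes "(q, g, a, U, q') \<in> edges A"
  shows "q < state_bound d" "q' < state_bound d" "a \<in> actions_over {..<state_bound d}"
proof -
  \<comment> \<open>Edges present in every body: they show that \<open>ctrl 0\<close> and the two
    messages of the loader are below \<open>d\<close>.\<close>
  have main: "(ctrl 1, {(0, Le, Param 0)}, Send msg_restart, {0}, ctrl 0) \<in> body_edges"
    and w: "(place 0, {}, Recv (msg_move 0 1), {}, cand 0 1) \<in> body_edges"
      "(cand 0 0, {}, Send msg_chosen, {}, place 0) \<in> body_edges"
    by (auto simp: body_edges_def main_edges_def worker_edges_def reg_bound_def)
  have msgs: "msg_move 0 1 < d" "msg_chosen < d"
    using body_edge_action[OF w(1)] body_edge_action[OF w(2)] by (auto simp: actions_over_def)
  have "ctrl 0 < d" using body_edge_less(2)[OF main] .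
  have "ctrl 2 < state_bound d"
  proof -
    have "2 \<le> d + d" using d_pos by simp
    then show ?thesis using prod_encode_mono[of 0 1 2 "d + d"] by (simp add: state_bound_def)
  qed
  have "q < state_bound d \<and> q' < state_bound d \<and> a \<in> actions_over {..<state_bound d}"
    using assms unfolding edges_eq
  proof (elim UnE)
    assume e: "(q, g, a, U, q') \<in> body_edges"
    have "actions_over {..<d} \<subseteq> actions_over {..<state_bound d}"
      using state_bound_ge(1) by (auto simp: actions_over_def)
    then show ?thesis
      using body_edge_less[OF e] body_edge_action[OF e] state_bound_ge(1) by auto
  next
    assume e: "(q, g, a, U, q') \<in> loader_edges"
    have 1: "ctrl d < state_bound d" "ctrl (d + d) < state_bound d"
      using state_bound_ge(2)[of 0] state_bound_ge(2)[of d] by auto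
    have 2: "ctrl (d + i) < state_bound d" "ctrl (Suc (d + i)) < state_bound d"
      "wait (Suc (d + i)) < state_bound d" if "i < d" for i
      using state_bound_ge(2)[of i] state_bound_ge(2)[of "Suc i"] state_bound_ge(3)[of "Suc i"] that
      by auto
    have 3: "ctrl 0 < state_bound d" "msg_move 0 1 < state_bound d" "msg_chosen < state_bound d"
      using msgs \<open>ctrl 0 < d\<close> state_bound_ge(1) by linarith+
    show ?thesis
      using e 1 2 3 \<open>ctrl 2 < state_bound d\<close>
      unfolding loader_edges_def actions_over_def by (auto simp del: One_nat_def)
  qed
  then show "q < state_bound d" "q' < state_bound d" "a \<in> actions_over {..<state_bound d}" by auto
qed

lemma finite_edges: "finite (edges A)"
  unfolding edges_eq using finite_body_edges by (simp add: loader_edges_def)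

lemma is_ptbp_protocol: "is_ptbp A"
proof -
  have "(idle, {(0, Le, Const 0)}, Send msg_start, {}, ctrl 0) \<in> edges A"
    by (simp add: edge_iff main_edges_def)
  then have "idle < state_bound d" by (rule edge_bounds)
  moreover have "edges A \<subseteq> {..<state_bound d} \<times> guards_over {0} {0} \<times>
      actions_over {..<state_bound d} \<times> Pow {0} \<times> {..<state_bound d}"
  proof
    fix e assume e: "e \<in> edges A"
    obtain q g a U q' where e': "e = (q, g, a, U, q')" by (cases e)
    have "g \<in> guards_over {0} {0}"
      using edge_shape(1)[of q g a U q'] e e' by (auto simp: guards_over_def constraints_over_def)
    then show "e \<in> {..<state_bound d} \<times> guards_over {0} {0} \<times>
      actions_over {..<state_bound d} \<times> Pow {0} \<times> {..<state_bound d}"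
      using edge_bounds[of q g a U q'] edge_shape(2)[of q g a U q'] e e' by auto
  qed
  moreover have "states A = {..<state_bound d}" "clocks A = {0}" "alphabet A = {..<state_bound d}"
    "params A = {0}" "init A = idle" by (simp_all add: protocol_def)
  ultimately show ?thesis unfolding is_ptbp_def using finite_edges by simp
qed

lemma is_LU_protocol: "is_LU A"
  unfolding is_LU_def
proof (rule exI[of _ "{0}"], rule exI[of _ "{}"], intro conjI)
  show "\<forall>(q, g, a, R, q') \<in> edges A. \<forall>(x, c, b) \<in> g. \<forall>p. b = Param p \<longrightarrow>
      (p \<in> {0} \<longrightarrow> c \<in> {Lt, Le}) \<and> (p \<in> {} \<longrightarrow> c \<in> {Gt, Ge})"
    using edge_shape(1) by fastforce
qed (auto simp: protocol_def)

lemma protocol_instance: "(A, \<lambda>_. LeftOpenIv 0 1, final) \<in> open_bounded_LU_one_clock"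
proof -
  have "(ctrl 0, {(0, Le, Param 0)}, Recv msg_time, {}, final) \<in> edges A"
    by (simp add: edge_iff main_edges_def)
  then have "final < state_bound d" by (rule edge_bounds)
  then show ?thesis
    using is_ptbp_protocol is_LU_protocol
    by (simp add: open_bounded_LU_one_clock_def open_bounded_def protocol_def)
qed

end

text \<open>Self-reference for an arbitrary program: \<open>d\<close> is determined by
  \<open>C\<close>, yet \<open>C\<close> is run on \<open>d\<close>, and the code of the instance is
  obtained from \<open>d\<close> by one function that is the same for all programs.\<close>

lemma program_instance:
  "\<exists>d. \<exists>I \<in> open_bounded_LU_one_clock. encode_instance I = instance_code d \<and>
     (exists_EF_universal I \<longleftrightarrow> (\<exists>s. ((\<lambda>_. 0)(0 := d), s) \<in> sem C))"
proof -
  obtain g :: "prog list \<Rightarrow> nat" where g: "inj_on g (conts C [])"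
    using finite_imp_inj_to_nat_seg[OF finite_conts] by metis
  \<comment> \<open>The shift by 3 keeps clear of the start, the halting point and the
    entry.\<close>
  define h where "h k = (if k = [] then 1 else if k = [C] then 2 else g k + 3)" for k
  interpret program C h
  proof
    show "inj_on h (insert [] (conts C []))"
      using g conts_not_Nil by (auto simp: inj_on_def h_def)
  qed (auto simp: h_def)
  show ?thesis
    using protocol_instance encode_protocol universal_iff_halts halts_iff by blast
qed

theorem theorem5:
  shows "\<not> decidable_on encode_instance open_bounded_LU_one_clock exists_EF_universal"
proof
  assume "decidable_on encode_instance open_bounded_LU_one_clock exists_EF_universal"
  then obtain f where f: "\<And>I. I \<in> open_bounded_LU_one_clock \<Longrightarrow>
      computes f [encode_instance I] (if exists_EF_universal I then 1 else 0)"
    unfolding decidable_on_def by blast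
  obtain r where r': "\<forall>xs. length xs = Suc 0 \<longrightarrow> computes r xs (instance_code (xs ! 0))"
    using recursive_instance_code unfolding recursive_def by blast
  have "computes r [n] (instance_code n)" for n
    using r'[rule_format, of "[n]"] by simp
  then have r: "computes r [n] y \<longleftrightarrow> y = instance_code n" for n y
    by (metis computes_unique)
  have self: "computes (Comp f [r]) [n] y \<longleftrightarrow> computes f [instance_code n] y" for n y
  proof -
    have "list_all2 (\<lambda>g y. computes g [n] y) [r] ys \<longleftrightarrow> ys = [instance_code n]" for ys
      by (auto simp: list_all2_Cons1 r)
    then show ?thesis by (simp add: computes_Comp_iff)
  qed
  \<comment> \<open>Input in register 0, answer in register 1, scratch space from 2 on. The final
    test turns the answer 0 into a halting run and any other answer into a stuck one.\<close>
  let ?C = "Seq (comp (Comp f [r]) [0] 1 2) (Atom (IfZero 1))"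
  have C: "(\<exists>s. ((\<lambda>_. 0)(0 := n), s) \<in> sem ?C) \<longleftrightarrow> computes f [instance_code n] 0" for n
  proof -
    have "((\<lambda>_. 0)(0 := n), s) \<in> sem (comp (Comp f [r]) [0] 1 2) \<longleftrightarrow>
        (\<exists>y. computes (Comp f [r]) [n] y \<and> s = ((\<lambda>_. 0)(0 := n))(1 := y))" for s
      using comp_okD[OF comp_correct, of "[0]" 2 1 "(\<lambda>_. 0)(0 := n)" s "Comp f [r]"]
      by (simp del: comp.simps)
    then show ?thesis unfolding self by (auto simp: relcomp_unfold simp del: comp.simps)
  qed
  \<comment> \<open>An instance that is positive exactly when \<open>f\<close> answers 0 on its
    code, i.e. when \<open>f\<close> rejects it.\<close>
  obtain d I where I: "I \<in> open_bounded_LU_one_clock" "encode_instance I = instance_code d"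
    "exists_EF_universal I \<longleftrightarrow> computes f [instance_code d] 0"
    using program_instance[of ?C] unfolding C by blast
  have "computes f [instance_code d] (if exists_EF_universal I then 1 else 0)"
    using f[OF I(1)] I(2) by simp
  with I(3) computes_unique[of f "[instance_code d]" 0 1] show False
    by (cases "exists_EF_universal I") auto
qed

end
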